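(* Let $A$ be an $N$-homogeneous algebra admitting a side-confluent presentation $\langle X\mid R\rangle$ with $X$ finite. Then for all integers $n\geq 0$ and $m\geq l_N(n)$, the reduction pair $P_{n,m}=(F_1^{n,m},F_2^{n,m})$ of bi-degree $(n,m)$ associated with $\langle X\mid R\rangle$ is confluent, i.e. there is an integer $k$ with $\langle F_1^{n,m},F_2^{n,m}\rangle^k=\langle F_2^{n,m},F_1^{n,m}\rangle^k$.
   Context: $\mathbb{K}$ is a field, $N\geq 2$. For a set $X$, $X^{(m)}$ is the set of words of length $m$, $V=\mathbb{K}X$, $V^{\otimes m}=\mathbb{K}X^{(m)}$, $T(V)$ the tensor (free) algebra. An $N$-homogeneous presentation $\langle X\mid R\rangle$ of $A$: $R\subset V^{\otimes N}$, $A\cong T(V)/I(R)$; $\overline R=\mathrm{span}(R)$, $I(R)_m=0$ for $m<N$, $I(R)_m=\sum_{i=0}^{m-N}V^{\otimes i}\otimes\overline R\otimes V^{\otimes m-N-i}$ for $m\geq N$. $X$ is totally ordered, $X^{(m)}$ ordered lexicographically, $\mathrm{lm}(f)$ the greatest word occurring in $f\neq0$. Conventions: elements of $R$ have leading coefficient $1$; a word is a normal form if it has no factor $\mathrm{lm}(f)$, $f\in R$; the presentation is reduced (for each $f\in R$, $\mathrm{lm}(f)-f$ is a linear combination of normal-form words and $\mathrm{lm}(f)$ has no factor $\mathrm{lm}(g)$, $g\in R\setminus\{f\}$). The operator $S\in\mathrm{End}(V^{\otimes N})$: $S(\mathrm{lm}(f))=\mathrm{lm}(f)-f$ for $f\in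 R$, $S(w)=w$ otherwise. $\langle t,s\rangle^k$ denotes $\cdots sts$ with $k$ factors. Side-confluent: for each $1\leq m\leq N-1$ some $k$ satisfies $\langle\mathrm{id}_{V^{\otimes m}}\otimes S,S\otimes\mathrm{id}_{V^{\otimes m}}\rangle^k=\langle S\otimes\mathrm{id}_{V^{\otimes m}},\mathrm{id}_{V^{\otimes m}}\otimes S\rangle^k$. $l_N(2k)=kN$, $l_N(2k+1)=kN+1$; $J_0=\mathbb{K}$, $J_1=V$, $J_2=\overline R$, $J_n=\bigcap_{i=0}^{l_N(n)-N}V^{\otimes i}\otimes\overline R\otimes V^{\otimes l_N(n)-N-i}$ for $n\geq3$. For a finite totally ordered set $Y$, a reduction operator relatively to $Y$ is a linear projector $T$ of $\mathbb{K}Y$ such that for each $y\in Y$ either $T(y)=y$ or $T(y)$ is a combination of elements strictly smaller than $y$ (possibly $0$). For every subspace $W$ of $\mathbb{K}Y$ there is a unique such $T$ with $\ker T=W$, denoted $\theta_Y^{-1}(W)$. Reduction pair of bi-degree $(n,m)$, $m\geq l_N(n)$: $F_1^{n,m}=\theta_{X^{(m)}}^{-1}(I(R)_{m-l_N(n)}\otimes V^{\otimes l_N(n)})$; $F_2^{n,m}=\mathrm{id}_{V^{\otimes m}}$ if $m<l_N(n+1)$ and $F_2^{n,m}=\theta_{X^{(m)}}^{-1}(V^{\otimes m-l_N(n+1)}\otimes J_{n+1})$ otherwise. *)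

theory Defs
  imports Main
begin

text \<open>Words over the alphabet 'x are lists; an element of the tensor algebra
  T(V), V = K X, is a function from words to coefficients.  V^{(m)} is the set of
  functions supported on words of length m.  Endomorphisms of V^{(m)} are given
  by their matrices: the image of each basis word of length m (and 0 elsewhere).\<close>

type_synonym ('x, 'k) vec = "'x list \<Rightarrow> 'k"
type_synonym ('x, 'k) op = "'x list \<Rightarrow> ('x, 'k) vec"

definition words :: "nat \<Rightarrow> 'x list set" where
  "words m = {w. length w = m}"

definition deg :: "nat \<Rightarrow> ('x, 'k::zero) vec \<Rightarrow> bool" where
  "deg m f \<longleftrightarrow> (\<forall>w. f w \<noteq> 0 \<longrightarrow> length w = m)"

definition Vm :: "nat \<Rightarrow> ('x, 'k::zero) vec set" where
  "Vm m = {f. deg m f}"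

definition wv :: "'x list \<Rightarrow> ('x, 'k::{zero,one}) vec" where
  "wv w = (\<lambda>v. if v = w then 1 else 0)"

definition lspan :: "('x, 'k::field) vec set \<Rightarrow> ('x, 'k) vec set" where
  "lspan S = {f. \<exists>F c. finite F \<and> F \<subseteq> S \<and> f = (\<lambda>v. \<Sum>g\<in>F. c g * g v)}"

definition tens :: "nat \<Rightarrow> ('x, 'k::field) vec set \<Rightarrow> ('x, 'k) vec set \<Rightarrow> ('x, 'k) vec set" where
  "tens a W U = lspan {(\<lambda>v. g (take a v) * h (drop a v)) | g h. g \<in> W \<and> h \<in> U}"

definition lm :: "('x::linorder, 'k::zero) vec \<Rightarrow> 'x list" where
  "lm f = (THE w. f w \<noteq> 0 \<and> (\<forall>v. f v \<noteq> 0 \<longrightarrow> v = w \<or> lexordp (<) v w))"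

definition factor :: "'x list \<Rightarrow> 'x list \<Rightarrow> bool" where
  "factor u w \<longleftrightarrow> (\<exists>p s. w = p @ u @ s)"

definition normal_form :: "('x::linorder, 'k::zero) vec set \<Rightarrow> 'x list \<Rightarrow> bool" where
  "normal_form R w \<longleftrightarrow> (\<forall>f\<in>R. \<not> factor (lm f) w)"

definition reduced_pres :: "nat \<Rightarrow> ('x::linorder, 'k::field) vec set \<Rightarrow> bool" where
  "reduced_pres N R \<longleftrightarrow>
     (\<forall>f\<in>R. f \<in> Vm N \<and> f \<noteq> (\<lambda>_. 0) \<and> f (lm f) = 1
        \<and> (\<forall>w. (wv (lm f) - f) w \<noteq> 0 \<longrightarrow> normal_form R w)
        \<and> (\<forall>g\<in>R. g \<noteq> f \<longrightarrow> \<not> factor (lm g) (lm f)))"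

definition app :: "('x, 'k::comm_ring_1) op \<Rightarrow> ('x, 'k) vec \<Rightarrow> ('x, 'k) vec" where
  "app T f = (\<lambda>v. \<Sum>w\<in>{w. f w \<noteq> 0}. f w * T w v)"

definition comp :: "('x, 'k::comm_ring_1) op \<Rightarrow> ('x, 'k) op \<Rightarrow> ('x, 'k) op" where
  "comp T U = (\<lambda>w. app T (U w))"

definition idm :: "nat \<Rightarrow> ('x, 'k::{zero,one}) op" where
  "idm m = (\<lambda>w. if length w = m then wv w else (\<lambda>_. 0))"

definition optens :: "nat \<Rightarrow> ('x, 'k::comm_ring_1) op \<Rightarrow> nat \<Rightarrow> ('x, 'k) op \<Rightarrow> ('x, 'k) op" where
  "optens a T b U = (\<lambda>w. if length w = a + b
      then (\<lambda>v. T (take a w) (take a v) * U (drop a w) (drop a v)) else (\<lambda>_. 0))"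

text \<open>alt m t s k = <t,s>^k = ... s t s  (k factors; identity of degree m for k = 0).\<close>
fun alt :: "nat \<Rightarrow> ('x, 'k::comm_ring_1) op \<Rightarrow> ('x, 'k) op \<Rightarrow> nat \<Rightarrow> ('x, 'k) op" where
  "alt m t s 0 = idm m"
| "alt m t s (Suc k) = comp (alt m s t k) s"

definition Sop :: "nat \<Rightarrow> ('x::linorder, 'k::field) vec set \<Rightarrow> ('x, 'k) op" where
  "Sop N R = (\<lambda>w. if length w = N then
      (if \<exists>f\<in>R. lm f = w then wv w - (THE f. f \<in> R \<and> lm f = w) else wv w)
    else (\<lambda>_. 0))"

definition side_confluent :: "nat \<Rightarrow> ('x::linorder, 'k::field) vec set \<Rightarrow> bool" where
  "side_confluent N R \<longleftrightarrow> (\<forall>m. 1 \<le> m \<and> m \<le> N - 1 \<longrightarrow>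
     (\<exists>k\<ge>1. alt (N + m) (optens m (idm m) N (Sop N R)) (optens N (Sop N R) m (idm m)) k
           = alt (N + m) (optens N (Sop N R) m (idm m)) (optens m (idm m) N (Sop N R)) k))"

definition lN :: "nat \<Rightarrow> nat \<Rightarrow> nat" where
  "lN N n = (n div 2) * N + n mod 2"

definition Rbar :: "('x, 'k::field) vec set \<Rightarrow> ('x, 'k) vec set" where
  "Rbar R = lspan R"

definition IR :: "nat \<Rightarrow> ('x, 'k::field) vec set \<Rightarrow> nat \<Rightarrow> ('x, 'k) vec set" where
  "IR N R m = (if m < N then {\<lambda>_. 0} else
     lspan (\<Union>i\<in>{0..m - N}. tens i (Vm i) (tens N (Rbar R) (Vm (m - N - i)))))"

definition J :: "nat \<Rightarrow> ('x, 'k::field) vec set \<Rightarrow> nat \<Rightarrow> ('x, 'k) vec set" where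
  "J N R n = (if n = 0 then Vm 0 else if n = 1 then Vm 1 else if n = 2 then Rbar R else
     (\<Inter>i\<in>{0..lN N n - N}. tens i (Vm i) (tens N (Rbar R) (Vm (lN N n - N - i)))))"

definition ker :: "nat \<Rightarrow> ('x, 'k::comm_ring_1) op \<Rightarrow> ('x, 'k) vec set" where
  "ker m T = {f. deg m f \<and> app T f = (\<lambda>_. 0)}"

definition reduction_op :: "nat \<Rightarrow> ('x::linorder, 'k::field) op \<Rightarrow> bool" where
  "reduction_op m T \<longleftrightarrow>
     (\<forall>w. length w \<noteq> m \<longrightarrow> T w = (\<lambda>_. 0)) \<and> (\<forall>w. deg m (T w)) \<and> comp T T = T \<and>
     (\<forall>w\<in>words m. T w = wv w \<or> (\<forall>v. T w v \<noteq> 0 \<longrightarrow> lexordp (<) v w))"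

definition theta_inv :: "nat \<Rightarrow> ('x::linorder, 'k::field) vec set \<Rightarrow> ('x, 'k) op" where
  "theta_inv m W = (THE T. reduction_op m T \<and> ker m T = W)"

definition F1 :: "nat \<Rightarrow> ('x::linorder, 'k::field) vec set \<Rightarrow> nat \<Rightarrow> nat \<Rightarrow> ('x, 'k) op" where
  "F1 N R n m = theta_inv m (tens (m - lN N n) (IR N R (m - lN N n)) (Vm (lN N n)))"

definition F2 :: "nat \<Rightarrow> ('x::linorder, 'k::field) vec set \<Rightarrow> nat \<Rightarrow> nat \<Rightarrow> ('x, 'k) op" where
  "F2 N R n m = (if m < lN N (n + 1) then idm m
     else theta_inv m (tens (m - lN N (n + 1)) (Vm (m - lN N (n + 1))) (J N R (n + 1))))"

end

theory Submission
  imports Defs "HOL-Library.List_Lexorder"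
begin

text \<open>
  A reduction operator is determined by its kernel, and the pair of operators with kernels A and B
  is confluent iff every word that leads both in A and in B leads in the intersection of A and B;
  equivalently, iff every leading word of A + B already leads in A or in B.  If the members of a
  family are pairwise confluent in this sense, then so is every pair consisting of a sum and an
  intersection of members.

  The family to which this is applied consists of the shifts of the span of R inside degree m.
  Two overlapping shifts are confluent by side-confluence, two disjoint ones because leading words
  can be multiplied.  The kernel of the first operator of the reduction pair is a sum of
  shifts, and that of the second an intersection of shifts, all vectors, or zero.
\<close>

section \<open>Leading terms of subspaces\<close>

definition lead :: "('y::linorder \<Rightarrow> 'k::zero) \<Rightarrow> 'y \<Rightarrow> bool" where
  "lead f w \<longleftrightarrow> f w \<noteq> 0 \<and> (\<forall>v. f v \<noteq> 0 \<longrightarrow> v \<le> w)"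

definition leads :: "('y::linorder \<Rightarrow> 'k::zero) set \<Rightarrow> 'y set" where
  "leads W = {w. \<exists>f\<in>W. lead f w}"

definition subsp :: "'y set \<Rightarrow> ('y \<Rightarrow> 'k::field) set \<Rightarrow> bool" where
  "subsp Y W \<longleftrightarrow> (\<lambda>_. 0) \<in> W \<and> (\<forall>f\<in>W. \<forall>g\<in>W. \<forall>c. (\<lambda>v. f v + c * g v) \<in> W)
     \<and> (\<forall>f\<in>W. \<forall>v. f v \<noteq> 0 \<longrightarrow> v \<in> Y)"

definition ssum :: "('y \<Rightarrow> 'k::field) set \<Rightarrow> ('y \<Rightarrow> 'k) set \<Rightarrow> ('y \<Rightarrow> 'k) set" where
  "ssum A B = {\<lambda>v. f v + g v | f g. f \<in> A \<and> g \<in> B}"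

definition confluent :: "('y::linorder \<Rightarrow> 'k::zero) set \<Rightarrow> ('y \<Rightarrow> 'k) set \<Rightarrow> bool" where
  "confluent A B \<longleftrightarrow> leads A \<inter> leads B \<subseteq> leads (A \<inter> B)"

lemma subsp_zero: "subsp Y W \<Longrightarrow> (\<lambda>_. 0) \<in> W"
  by (simp add: subsp_def)

lemma subsp_lincomb: "subsp Y W \<Longrightarrow> f \<in> W \<Longrightarrow> g \<in> W \<Longrightarrow> (\<lambda>v. f v + c * g v) \<in> W"
  by (simp add: subsp_def)

lemma subsp_add: "subsp Y W \<Longrightarrow> f \<in> W \<Longrightarrow> g \<in> W \<Longrightarrow> (\<lambda>v. f v + g v) \<in> W"
  using subsp_lincomb[of Y W f g 1] by simp

lemma subsp_diff: "subsp Y W \<Longrightarrow> f \<in> W \<Longrightarrow> g \<in> W \<Longrightarrow> (\<lambda>v. f v - g v) \<in> W"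
  using subsp_lincomb[of Y W f g "-1"] by simp

lemma subsp_scale: "subsp Y W \<Longrightarrow> g \<in> W \<Longrightarrow> (\<lambda>v. c * g v) \<in> W"
  using subsp_lincomb[of Y W "\<lambda>_. 0" g c] subsp_zero by auto

lemma subsp_supp: "subsp Y W \<Longrightarrow> f \<in> W \<Longrightarrow> f v \<noteq> 0 \<Longrightarrow> v \<in> Y"
  by (simp add: subsp_def)

lemma subsp_sum:
  "finite I \<Longrightarrow> subsp Y W \<Longrightarrow> (\<And>i. i \<in> I \<Longrightarrow> h i \<in> W) \<Longrightarrow> (\<lambda>v. \<Sum>i\<in>I. c i * h i v) \<in> W"
proof (induction I rule: finite_induct)
  case empty
  then show ?case by (simp add: subsp_zero)
next
  case (insert i I)
  then have "(\<lambda>v. (\<Sum>i\<in>I. c i * h i v) + c i * h i v) \<in> W"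
    by (intro subsp_lincomb) auto
  with insert show ?case by (simp add: add.commute)
qed

lemma subsp_Int: "subsp Y A \<Longrightarrow> subsp Y B \<Longrightarrow> subsp Y (A \<inter> B)"
  unfolding subsp_def by blast

lemma subsp_INT:
  "I \<noteq> {} \<Longrightarrow> (\<And>i. i \<in> I \<Longrightarrow> subsp Y (E i)) \<Longrightarrow> subsp Y (\<Inter>i\<in>I. E i)"
  unfolding subsp_def by (intro conjI) (simp, simp, metis INT_E all_not_in_conv)

lemma ssumI: "a \<in> A \<Longrightarrow> b \<in> B \<Longrightarrow> (\<lambda>v. a v + b v) \<in> ssum A B"
  unfolding ssum_def by blast

lemma subsp_ssum:
  assumes A: "subsp Y A" and B: "subsp Y B"
  shows "subsp Y (ssum A B)"
  unfolding subsp_def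
proof (intro conjI ballI allI impI)
  show "(\<lambda>_. 0) \<in> ssum A B"
    using ssumI[OF subsp_zero[OF A] subsp_zero[OF B]] by simp
next
  fix f g c assume "f \<in> ssum A B" "g \<in> ssum A B"
  then obtain a b a' b' where *: "f = (\<lambda>v. a v + b v)" "g = (\<lambda>v. a' v + b' v)"
    "a \<in> A" "b \<in> B" "a' \<in> A" "b' \<in> B" unfolding ssum_def by blast
  then have "(\<lambda>v. (a v + c * a' v) + (b v + c * b' v)) \<in> ssum A B"
    by (intro ssumI subsp_lincomb[OF A] subsp_lincomb[OF B])
  then show "(\<lambda>v. f v + c * g v) \<in> ssum A B" by (simp add: * algebra_simps)
next
  fix f v assume "f \<in> ssum A B" "f v \<noteq> 0"
  then obtain a b where *: "f = (\<lambda>v. a v + b v)" "a \<in> A" "b \<in> B"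
    unfolding ssum_def by blast
  with \<open>f v \<noteq> 0\<close> have "a v \<noteq> 0 \<or> b v \<noteq> 0" by auto
  with * show "v \<in> Y" using subsp_supp[OF A] subsp_supp[OF B] by blast
qed

lemma ssum_upper1: "subsp Y B \<Longrightarrow> A \<subseteq> ssum A B"
  using ssumI[of _ A "\<lambda>_. 0" B] subsp_zero by fastforce

lemma ssum_upper2: "subsp Y A \<Longrightarrow> B \<subseteq> ssum A B"
  using ssumI[of "\<lambda>_. 0" A _ B] subsp_zero by fastforce

lemma lead_unique: "lead f v \<Longrightarrow> lead f w \<Longrightarrow> v = w"
  unfolding lead_def by (meson order.antisym)

lemma lead_ex:
  assumes "finite Y" "\<forall>v. f v \<noteq> 0 \<longrightarrow> v \<in> Y" "f \<noteq> (\<lambda>_. 0)"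
  obtains w where "lead f w" "w \<in> Y"
proof -
  let ?Z = "{v. f v \<noteq> 0}"
  have "finite ?Z" "?Z \<noteq> {}" using assms by (auto intro: finite_subset[of _ Y])
  then have "Max ?Z \<in> ?Z" "\<forall>v\<in>?Z. v \<le> Max ?Z" by (meson Max_in, simp)
  then show ?thesis using assms(2) that[of "Max ?Z"] unfolding lead_def by blast
qed

lemma leads_mono: "A \<subseteq> B \<Longrightarrow> leads A \<subseteq> leads B"
  unfolding leads_def by blast

lemma leads_sub: "subsp Y W \<Longrightarrow> leads W \<subseteq> Y"
  using subsp_supp[of Y W] by (auto simp: leads_def lead_def)

lemma leads_zero [simp]: "leads {\<lambda>_. 0} = {}"
  unfolding leads_def lead_def by simp

lemma finite_less_induct [consumes 2, case_names less]:
  fixes w :: "'y::linorder"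
  assumes "finite Y" "w \<in> Y"
    and step: "\<And>w. w \<in> Y \<Longrightarrow> (\<And>v. v \<in> Y \<Longrightarrow> v < w \<Longrightarrow> P v) \<Longrightarrow> P w"
  shows "P w"
  using \<open>w \<in> Y\<close>
proof (induction "card {v\<in>Y. v < w}" arbitrary: w rule: less_induct)
  case less
  show ?case
  proof (rule step[OF less.prems])
    fix v assume v: "v \<in> Y" "v < w"
    then have "{u\<in>Y. u < v} \<subset> {u\<in>Y. u < w}" by (auto dest: less_trans)
    with \<open>finite Y\<close> v show "P v" by (intro less.hyps psubset_card_mono) auto
  qed
qed

lemma vec_induct [consumes 2, case_names less]:
  fixes f :: "'y::linorder \<Rightarrow> 'k::zero"
  assumes fin: "finite Y" and "\<forall>v. f v \<noteq> 0 \<longrightarrow> v \<in> Y"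
    and step: "\<And>f. \<forall>v. f v \<noteq> 0 \<longrightarrow> v \<in> Y \<Longrightarrow>
      (\<And>g w. lead f w \<Longrightarrow> \<forall>v. g v \<noteq> 0 \<longrightarrow> v \<in> Y \<and> v < w \<Longrightarrow> P g) \<Longrightarrow> P f"
  shows "P f"
  using assms(2)
proof (induction "card {v\<in>Y. \<exists>u. f u \<noteq> 0 \<and> v \<le> u}" arbitrary: f rule: less_induct)
  case less
  show ?case
  proof (rule step)
    show "\<forall>v. f v \<noteq> 0 \<longrightarrow> v \<in> Y" by (fact less.prems)
    fix g :: "'y \<Rightarrow> 'k" and w
    assume f: "lead f w" and g: "\<forall>v. g v \<noteq> 0 \<longrightarrow> v \<in> Y \<and> v < w"
    let ?G = "{v\<in>Y. \<exists>u. g u \<noteq> 0 \<and> v \<le> u}" and ?F = "{v\<in>Y. \<exists>u. f u \<noteq> 0 \<and> v \<le> u}"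
    have "?G \<subseteq> ?F"
    proof
      fix v assume "v \<in> ?G"
      then obtain u where "v \<in> Y" "v \<le> u" "g u \<noteq> 0" by blast
      with g have "v \<le> w" by (meson less_imp_le order.trans)
      with f \<open>v \<in> Y\<close> show "v \<in> ?F" unfolding lead_def by blast
    qed
    moreover have "w \<in> ?F" using f less.prems unfolding lead_def by auto
    moreover have "w \<notin> ?G" using g by force
    ultimately have "?G \<subset> ?F" by blast
    with fin g show "P g" by (intro less.hyps psubset_card_mono) auto
  qed
qed

lemma cancel_lead:
  fixes f g :: "'y::linorder \<Rightarrow> 'k::field"
  assumes "lead f w" "lead g w" "f v - f w / g w * g v \<noteq> 0"
  shows "v < w"
proof -
  have "v \<noteq> w" using assms by (auto simp: lead_def)
  moreover have "f v \<noteq> 0 \<or> g v \<noteq> 0" using assms(3) by auto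
  ultimately show ?thesis using assms(1,2) by (auto simp: lead_def order.strict_iff_order)
qed

lemma confluent_commute: "confluent A B \<longleftrightarrow> confluent B A"
  by (simp add: confluent_def Int_commute)

lemma confluent_subset: "A \<subseteq> B \<Longrightarrow> confluent A B"
  by (simp add: confluent_def inf.absorb1)

text \<open>A sum a + b whose leading terms cancel is rewritten with smaller leading terms by
  moving a multiple of an element of the intersection from a to b.\<close>

lemma leads_ssum:
  fixes A B :: "('y::linorder \<Rightarrow> 'k::field) set"
  assumes fin: "finite Y" and A: "subsp Y A" and B: "subsp Y B" and confluent: "confluent A B"
  shows "leads (ssum A B) = leads A \<union> leads B"
proof
  have *: "a \<in> A \<longrightarrow> (\<forall>b w. b \<in> B \<longrightarrow> lead (\<lambda>v. a v + b v) w \<longrightarrow> w \<in> leads A \<union> leads B)"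
    if "\<forall>v. a v \<noteq> 0 \<longrightarrow> v \<in> Y" for a
    using fin that
  proof (induction a rule: vec_induct)
    case (less a)
    show ?case
    proof (intro impI allI)
      fix b w assume a: "a \<in> A" and b: "b \<in> B" and w: "lead (\<lambda>v. a v + b v) w"
      show "w \<in> leads A \<union> leads B"
      proof (cases "a = (\<lambda>_. 0) \<or> b = (\<lambda>_. 0)")
        case True
        then show ?thesis using w a b unfolding leads_def by auto
      next
        case False
        obtain u where u: "lead a u" using lead_ex[OF fin less.hyps] False by blast
        obtain u' where u': "lead b u'" using lead_ex[OF fin, of b] subsp_supp[OF B b] False by blast
        show ?thesis
        proof (cases "u = u' \<and> a u + b u = 0")
          case False
          have "lead (\<lambda>v. a v + b v) (max u u')"
          proof (cases u u' rule: linorder_cases)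
            case less
            then have "a u' = 0" using u unfolding lead_def by (meson leD)
            with less u u' show ?thesis unfolding lead_def
              by (auto simp: max_def) (metis add_0 order.trans less_imp_le)
          next
            case equal
            with u u' False show ?thesis unfolding lead_def by (auto simp: max_def) (metis add_0)
          next
            case greater
            then have "b u = 0" using u' unfolding lead_def by (meson leD)
            with greater u u' show ?thesis unfolding lead_def
              by (auto simp: max_def) (metis add_0 order.trans less_imp_le)
          qed
          then have "w = max u u'" using w lead_unique by blast
          then show ?thesis using u u' a b unfolding leads_def max_def by auto
        next
          case True
          then have "u \<in> leads A \<inter> leads B" using u u' a b unfolding leads_def by auto
          then obtain g where g: "g \<in> A" "g \<in> B" "lead g u"
            using confluent unfolding confluent_def leads_def by blast
          let ?a = "\<lambda>v. a v + (- (a u / g u)) * g v" and ?b = "\<lambda>v. b v + a u / g u * g v"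
          have aA: "?a \<in> A" by (intro subsp_lincomb[OF A] a g)
          moreover have "?b \<in> B" by (intro subsp_lincomb[OF B] b g)
          moreover have "lead (\<lambda>v. ?a v + ?b v) w" using w by simp
          moreover have "v \<in> Y \<and> v < u" if "?a v \<noteq> 0" for v
            using cancel_lead[OF u g(3)] subsp_supp[OF A aA] that by auto
          ultimately show ?thesis using less.IH[OF u, of ?a] by blast
        qed
      qed
    qed
  qed
  show "leads (ssum A B) \<subseteq> leads A \<union> leads B"
  proof
    fix w assume "w \<in> leads (ssum A B)"
    then obtain a b where "a \<in> A" "b \<in> B" "lead (\<lambda>v. a v + b v) w"
      unfolding leads_def ssum_def by blast
    with * subsp_supp[OF A] show "w \<in> leads A \<union> leads B" by blast
  qed
  show "leads A \<union> leads B \<subseteq> leads (ssum A B)"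
    using leads_mono[OF ssum_upper1[OF B]] leads_mono[OF ssum_upper2[OF A]] by blast
qed

lemma confluent_if_leads_ssum:
  fixes A B :: "('y::linorder \<Rightarrow> 'k::field) set"
  assumes fin: "finite Y" and A: "subsp Y A" and B: "subsp Y B"
    and le: "leads (ssum A B) \<subseteq> leads A \<union> leads B"
  shows "confluent A B"
proof -
  have S: "subsp Y (ssum A B)" using A B by (rule subsp_ssum)
  have decomp: "h \<in> ssum A B \<longrightarrow> (\<exists>a\<in>A. \<exists>b\<in>B. h = (\<lambda>v. a v + b v) \<and>
      (\<forall>u. (\<forall>v. h v \<noteq> 0 \<longrightarrow> v < u) \<longrightarrow> (\<forall>v. a v \<noteq> 0 \<longrightarrow> v < u) \<and> (\<forall>v. b v \<noteq> 0 \<longrightarrow> v < u)))"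
    if "\<forall>v. h v \<noteq> 0 \<longrightarrow> v \<in> Y" for h
    using fin that
  proof (induction h rule: vec_induct)
    case (less h)
    show ?case
    proof (intro impI)
      assume h: "h \<in> ssum A B"
      show "\<exists>a\<in>A. \<exists>b\<in>B. h = (\<lambda>v. a v + b v) \<and>
        (\<forall>u. (\<forall>v. h v \<noteq> 0 \<longrightarrow> v < u) \<longrightarrow> (\<forall>v. a v \<noteq> 0 \<longrightarrow> v < u) \<and> (\<forall>v. b v \<noteq> 0 \<longrightarrow> v < u))"
      proof (cases "h = (\<lambda>_. 0)")
        case True
        then show ?thesis using subsp_zero[OF A] subsp_zero[OF B] by force
      next
        case False
        then obtain w where w: "lead h w" using lead_ex[OF fin less.hyps] by blast
        with le h have "w \<in> leads A \<union> leads B" unfolding leads_def by blast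
        then obtain g where g: "g \<in> A \<or> g \<in> B" "lead g w" unfolding leads_def by blast
        let ?c = "h w / g w"
        let ?h = "\<lambda>v. h v + (- ?c) * g v"
        have hS: "?h \<in> ssum A B"
          using g ssum_upper1[OF B, of A] ssum_upper2[OF A, of B] by (intro subsp_lincomb[OF S] h) auto
        have lt: "\<forall>v. ?h v \<noteq> 0 \<longrightarrow> v \<in> Y \<and> v < w"
          using cancel_lead[OF w g(2)] subsp_supp[OF S hS] by auto
        from less.IH[OF w lt, rule_format, OF hS] obtain a b where ab: "a \<in> A" "b \<in> B" "?h = (\<lambda>v. a v + b v)"
          "\<forall>u. (\<forall>v. ?h v \<noteq> 0 \<longrightarrow> v < u) \<longrightarrow> (\<forall>v. a v \<noteq> 0 \<longrightarrow> v < u) \<and> (\<forall>v. b v \<noteq> 0 \<longrightarrow> v < u)"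
          by blast
        have small: "v < w" if "a v \<noteq> 0 \<or> b v \<noteq> 0" for v using ab(4) lt that by blast
        have gw: "v \<le> w" if "g v \<noteq> 0" for v using g(2) that unfolding lead_def by blast
        have hv: "h v = a v + b v + ?c * g v" for v
          using fun_cong[OF ab(3), of v] by (simp add: algebra_simps)
        have wu: "w < u" if "\<forall>v. h v \<noteq> 0 \<longrightarrow> v < u" for u
          using w that unfolding lead_def by blast
        from g(1) show ?thesis
        proof
          assume "g \<in> A"
          then have "(\<lambda>v. a v + ?c * g v) \<in> A" using ab by (intro subsp_lincomb[OF A])
          moreover have "v \<le> w" if "a v + ?c * g v \<noteq> 0" for v
            using small[of v] gw[of v] that by fastforce
          moreover have "h = (\<lambda>v. (a v + ?c * g v) + b v)"
          proof
            fix v show "h v = (a v + ?c * g v) + b v" using hv[of v] by (simp only: ac_simps)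
          qed
          moreover have "(\<forall>v. a v + ?c * g v \<noteq> 0 \<longrightarrow> v < u) \<and> (\<forall>v. b v \<noteq> 0 \<longrightarrow> v < u)"
            if "\<forall>v. h v \<noteq> 0 \<longrightarrow> v < u" for u
            using wu[OF that] small calculation(2) by (meson le_less_trans less_trans)
          ultimately show ?thesis using ab(2)
            by (intro bexI[of _ "\<lambda>v. a v + ?c * g v"] bexI[of _ b] conjI allI impI) (assumption | blast)+
        next
          assume "g \<in> B"
          then have "(\<lambda>v. b v + ?c * g v) \<in> B" using ab by (intro subsp_lincomb[OF B])
          moreover have "v \<le> w" if "b v + ?c * g v \<noteq> 0" for v
            using small[of v] gw[of v] that by fastforce
          moreover have "h = (\<lambda>v. a v + (b v + ?c * g v))"
          proof
            fix v show "h v = a v + (b v + ?c * g v)" using hv[of v] by (simp only: ac_simps)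
          qed
          moreover have "(\<forall>v. b v + ?c * g v \<noteq> 0 \<longrightarrow> v < u) \<and> (\<forall>v. a v \<noteq> 0 \<longrightarrow> v < u)"
            if "\<forall>v. h v \<noteq> 0 \<longrightarrow> v < u" for u
            using wu[OF that] small calculation(2) by (meson le_less_trans less_trans)
          ultimately show ?thesis using ab(1)
            by (intro bexI[of _ "\<lambda>v. b v + ?c * g v"] bexI[of _ a] conjI allI impI) (assumption | blast)+
        qed
      qed
    qed
  qed
  show ?thesis unfolding confluent_def
  proof
    fix w assume "w \<in> leads A \<inter> leads B"
    then obtain a b where a: "a \<in> A" "lead a w" and b: "b \<in> B" "lead b w"
      unfolding leads_def by blast
    let ?h = "\<lambda>v. a v + (- (a w / b w)) * b v"
    have h: "?h \<in> ssum A B"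
      using a b ssum_upper1[OF B, of A] ssum_upper2[OF A, of B] by (intro subsp_lincomb[OF S]) auto
    have lt: "v < w" if "?h v \<noteq> 0" for v using cancel_lead[OF a(2) b(2), of v] that by simp
    have "\<forall>v. ?h v \<noteq> 0 \<longrightarrow> v \<in> Y" using subsp_supp[OF S h] by blast
    from decomp[OF this, rule_format, OF h] obtain a' b' where ab: "a' \<in> A" "b' \<in> B"
      "?h = (\<lambda>v. a' v + b' v)"
      "\<forall>u. (\<forall>v. ?h v \<noteq> 0 \<longrightarrow> v < u) \<longrightarrow> (\<forall>v. a' v \<noteq> 0 \<longrightarrow> v < u) \<and> (\<forall>v. b' v \<noteq> 0 \<longrightarrow> v < u)"
      by blast
    let ?f = "\<lambda>v. a v - a' v"
    have "?f \<in> A" using a ab by (intro subsp_diff[OF A])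
    moreover have "?f = (\<lambda>v. b' v + (a w / b w) * b v)"
    proof
      fix v show "a v - a' v = b' v + (a w / b w) * b v"
        using fun_cong[OF ab(3), of v] by (simp add: algebra_simps)
    qed
    then have "?f \<in> B" using subsp_lincomb[OF B ab(2) b(1)] by (simp only:)
    moreover have "lead ?f w"
    proof -
      have "v < w" if "a' v \<noteq> 0" for v using ab(4) lt that by blast
      then have "a' w = 0" "\<And>v. a v - a' v \<noteq> 0 \<Longrightarrow> v \<le> w"
        using a(2) unfolding lead_def by (auto dest: less_imp_le) (metis diff_0_right less_imp_le)
      then show ?thesis using a(2) unfolding lead_def by simp
    qed
    ultimately show "w \<in> leads (A \<inter> B)" unfolding leads_def by blast
  qed
qed

lemma confluent_ssum:
  fixes A B C :: "('y::linorder \<Rightarrow> 'k::field) set"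
  assumes "finite Y" "subsp Y A" "subsp Y B" "confluent A B" "confluent A C" "confluent B C"
  shows "confluent (ssum A B) C"
  using leads_mono[of "A \<inter> C" "ssum A B \<inter> C"] leads_mono[of "B \<inter> C" "ssum A B \<inter> C"]
    ssum_upper1[OF assms(3), of A] ssum_upper2[OF assms(2), of B] leads_ssum[OF assms(1-4)]
    assms(5,6)
  unfolding confluent_def by blast

text \<open>The sum of \<open>A \<inter> C\<close> and \<open>B \<inter> C\<close> lies in the intersection of A + B with C, whose leading
  words are controlled by the hypotheses; hence \<open>A \<inter> C\<close> and \<open>B \<inter> C\<close> are confluent.\<close>

lemma confluent_Int:
  fixes A B C :: "('y::linorder \<Rightarrow> 'k::field) set"
  assumes fin: "finite Y" and A: "subsp Y A" and B: "subsp Y B" and C: "subsp Y C"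
    and AB: "confluent A B" and AC: "confluent A C" and BC: "confluent B C"
  shows "confluent (A \<inter> B) C"
proof -
  let ?D = "ssum (A \<inter> C) (B \<inter> C)"
  have AC': "subsp Y (A \<inter> C)" and BC': "subsp Y (B \<inter> C)" using A B C by (auto intro: subsp_Int)
  have sub: "?D \<subseteq> ssum A B \<inter> C"
    using subsp_add[OF C] unfolding ssum_def by blast
  have "leads (ssum A B \<inter> C) \<subseteq> leads (ssum A B) \<inter> leads C"
    using leads_mono[of "ssum A B \<inter> C" "ssum A B"] leads_mono[of "ssum A B \<inter> C" C] by blast
  also have "\<dots> \<subseteq> leads (A \<inter> C) \<union> leads (B \<inter> C)"
    using leads_ssum[OF fin A B AB] AC BC unfolding confluent_def by blast
  finally have up: "leads (ssum A B \<inter> C) \<subseteq> leads (A \<inter> C) \<union> leads (B \<inter> C)" .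
  have "leads ?D \<subseteq> leads (A \<inter> C) \<union> leads (B \<inter> C)"
    using up leads_mono[OF sub] by blast
  then have "confluent (A \<inter> C) (B \<inter> C)"
    by (rule confluent_if_leads_ssum[OF fin AC' BC'])
  moreover have "leads (A \<inter> B) \<subseteq> leads A \<inter> leads B"
    using leads_mono[of "A \<inter> B" A] leads_mono[of "A \<inter> B" B] by blast
  moreover have "(A \<inter> C) \<inter> (B \<inter> C) = A \<inter> B \<inter> C" by blast
  ultimately show ?thesis using AC BC unfolding confluent_def by (simp only:) blast
qed

lemma confluent_INT:
  fixes E :: "'i \<Rightarrow> ('y::linorder \<Rightarrow> 'k::field) set"
  assumes fin: "finite Y" and "finite I" "I \<noteq> {}" and E: "\<And>i. i \<in> I \<Longrightarrow> subsp Y (E i)"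
    and C: "subsp Y C"
    and "\<And>i j. i \<in> I \<Longrightarrow> j \<in> I \<Longrightarrow> confluent (E i) (E j)" "\<And>i. i \<in> I \<Longrightarrow> confluent (E i) C"
  shows "confluent (\<Inter>i\<in>I. E i) C"
  using assms(2-7)
proof (induction I arbitrary: C rule: finite_ne_induct)
  case (singleton i)
  then show ?case by simp
next
  case (insert i I)
  have "confluent (\<Inter>i\<in>I. E i) (E i)" using insert.prems by (intro insert.IH) auto
  moreover have "confluent (\<Inter>i\<in>I. E i) C" using insert.prems by (intro insert.IH) auto
  moreover have "subsp Y (\<Inter>i\<in>I. E i)" using insert.prems insert.hyps by (intro subsp_INT) auto
  ultimately show ?case
    using insert.prems confluent_Int[OF fin, of "E i" "\<Inter>i\<in>I. E i" C]
    by (simp add: confluent_commute[of "E i" "\<Inter>i\<in>I. E i"])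
qed

section \<open>Spans and operators on words\<close>

lemma lexordp_iff_less: "lexordp (<) v w \<longleftrightarrow> v < w"
  by (simp add: list_less_def lexordp_def)

lemma words_iff [simp]: "w \<in> words m \<longleftrightarrow> length w = m"
  by (simp add: words_def)

lemma finite_words [simp]: "finite (words m :: 'x::finite list set)"
  using finite_lists_length_eq[of "UNIV :: 'x set" m] by (simp add: words_def)

lemma subsp_deg: "subsp (words m) W \<Longrightarrow> f \<in> W \<Longrightarrow> deg m f"
  unfolding deg_def using subsp_supp by fastforce

lemma deg_lincomb:
  fixes f g :: "('x, 'k::field) vec"
  assumes "deg m f" "deg m g"
  shows "deg m (\<lambda>v. f v + c * g v)"
  unfolding deg_def
proof (intro allI impI)
  fix v assume "f v + c * g v \<noteq> 0"
  then have "f v \<noteq> 0 \<or> g v \<noteq> 0" by auto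
  with assms show "length v = m" unfolding deg_def by blast
qed

lemma subsp_Vm: "subsp (words m) (Vm m)"
  unfolding subsp_def Vm_def by (simp add: deg_lincomb) (simp add: deg_def)

lemma lspan_base: "f \<in> S \<Longrightarrow> f \<in> lspan S"
  unfolding lspan_def by (intro CollectI exI[of _ "{f}"] exI[of _ "\<lambda>_. 1"]) simp

lemma lspan_least: "subsp Y W \<Longrightarrow> S \<subseteq> W \<Longrightarrow> lspan S \<subseteq> W"
  unfolding lspan_def using subsp_sum[of _ Y W "\<lambda>g. g"] by blast

lemma lspan_mono: "S \<subseteq> T \<Longrightarrow> lspan S \<subseteq> lspan T"
  unfolding lspan_def by blast

lemma subsp_lspan:
  assumes "\<And>f v. f \<in> S \<Longrightarrow> f v \<noteq> 0 \<Longrightarrow> v \<in> Y"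
  shows "subsp Y (lspan S)"
  unfolding subsp_def
proof (intro conjI ballI allI impI)
  show "(\<lambda>_. 0) \<in> lspan S"
    unfolding lspan_def by (intro CollectI exI[of _ "{}"] exI) simp
next
  fix f g c assume "f \<in> lspan S" "g \<in> lspan S"
  then obtain F a G b where F: "finite F" "F \<subseteq> S" "f = (\<lambda>v. \<Sum>h\<in>F. a h * h v)"
    and G: "finite G" "G \<subseteq> S" "g = (\<lambda>v. \<Sum>h\<in>G. b h * h v)"
    unfolding lspan_def by blast
  let ?d = "\<lambda>h. (if h \<in> F then a h else 0) + c * (if h \<in> G then b h else 0)"
  have "f v + c * g v = (\<Sum>h\<in>F \<union> G. ?d h * h v)" for v
  proof -
    have "f v = (\<Sum>h\<in>F \<union> G. (if h \<in> F then a h else 0) * h v)"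
      unfolding F(3) using F(1) G(1) by (intro sum.mono_neutral_cong_left) auto
    moreover have "g v = (\<Sum>h\<in>F \<union> G. (if h \<in> G then b h else 0) * h v)"
      unfolding G(3) using F(1) G(1) by (intro sum.mono_neutral_cong_left) auto
    ultimately show ?thesis
      by (simp add: sum_distrib_left sum.distrib[symmetric] distrib_right mult.assoc)
  qed
  then show "(\<lambda>v. f v + c * g v) \<in> lspan S"
    unfolding lspan_def using F G
    by (intro CollectI exI[of _ "F \<union> G"] exI[of _ ?d]) auto
next
  fix f v assume "f \<in> lspan S" "f v \<noteq> 0"
  then obtain F a where "F \<subseteq> S" "f = (\<lambda>v. \<Sum>h\<in>F. a h * h v)"
    unfolding lspan_def by blast
  with \<open>f v \<noteq> 0\<close> obtain h where "h \<in> S" "h v \<noteq> 0"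
    by (metis (no_types, lifting) mult_zero_right subsetD sum.neutral)
  then show "v \<in> Y" by (rule assms)
qed

lemma lspan_empty: "lspan {} = {\<lambda>_. 0}"
  unfolding lspan_def by auto

lemma lspan_Un:
  assumes A: "subsp Y A" and B: "\<And>f v. f \<in> B \<Longrightarrow> f v \<noteq> 0 \<Longrightarrow> v \<in> Y"
  shows "lspan (A \<union> B) = ssum A (lspan B)"
proof
  have LB: "subsp Y (lspan B)" using B by (rule subsp_lspan)
  have "A \<union> B \<subseteq> ssum A (lspan B)"
    using ssum_upper1[OF LB, of A] ssum_upper2[OF A, of "lspan B"] lspan_base by blast
  then show "lspan (A \<union> B) \<subseteq> ssum A (lspan B)"
    by (rule lspan_least[OF subsp_ssum[OF A LB]])
  have AB: "subsp Y (lspan (A \<union> B))" using subsp_supp[OF A] B by (intro subsp_lspan) blast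
  have "A \<subseteq> lspan (A \<union> B)" "lspan B \<subseteq> lspan (A \<union> B)"
    using lspan_mono[of B "A \<union> B"] lspan_base by blast+
  then show "ssum A (lspan B) \<subseteq> lspan (A \<union> B)"
    unfolding ssum_def by (auto intro!: subsp_add[OF AB])
qed

lemma confluent_lspan_UN:
  fixes E :: "'i \<Rightarrow> ('x::linorder, 'k::field) vec set"
  assumes fin: "finite Y" and "finite I" and "\<And>i. i \<in> I \<Longrightarrow> subsp Y (E i)"
    and "\<And>i j. i \<in> I \<Longrightarrow> j \<in> I \<Longrightarrow> confluent (E i) (E j)" "\<And>i. i \<in> I \<Longrightarrow> confluent (E i) C"
  shows "confluent (lspan (\<Union>i\<in>I. E i)) C"
  using assms(2-5)
proof (induction I arbitrary: C rule: finite_induct)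
  case empty
  then show ?case by (simp add: lspan_empty confluent_def)
next
  case (insert i I)
  have supp: "v \<in> Y" if "f \<in> (\<Union>i\<in>I. E i)" "f v \<noteq> 0" for f v
    using insert.prems(1) subsp_supp[of Y _ f v] that by (meson UN_E insertI2)
  have "confluent (lspan (\<Union>i\<in>I. E i)) (E i)" using insert.prems by (intro insert.IH) auto
  moreover have "confluent (lspan (\<Union>i\<in>I. E i)) C" using insert.prems by (intro insert.IH) auto
  moreover have "lspan (\<Union>i\<in>insert i I. E i) = ssum (E i) (lspan (\<Union>i\<in>I. E i))"
    using lspan_Un[OF insert.prems(1)[of i], of "\<Union>i\<in>I. E i"] supp by simp
  moreover have "subsp Y (lspan (\<Union>i\<in>I. E i))" using supp by (rule subsp_lspan)
  ultimately show ?case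
    using insert.prems confluent_ssum[OF fin, of "E i" "lspan (\<Union>i\<in>I. E i)" C]
    by (simp add: confluent_commute[of "E i" "lspan (\<Union>i\<in>I. E i)"])
qed

lemma app_words:
  fixes f :: "('x::finite, 'k::field) vec"
  assumes "deg m f"
  shows "app T f v = (\<Sum>w\<in>words m. f w * T w v)"
  unfolding app_def using assms by (intro sum.mono_neutral_left) (auto simp: deg_def)

lemma deg_wv: "length w = m \<Longrightarrow> deg m (wv w)"
  by (simp add: deg_def wv_def)

lemma deg_zero: "deg m (\<lambda>_. 0)"
  by (simp add: deg_def)

lemma app_lincomb:
  fixes f g :: "('x::finite, 'k::field) vec"
  assumes "deg m f" "deg m g"
  shows "app T (\<lambda>v. f v + c * g v) = (\<lambda>v. app T f v + c * app T g v)"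
  unfolding app_words[OF deg_lincomb[OF assms]] app_words[OF assms(1)] app_words[OF assms(2)]
  by (simp add: distrib_right sum.distrib sum_distrib_left mult.assoc)

lemma app_zero: "app T (\<lambda>_. 0) = (\<lambda>_. 0)"
  by (simp add: app_def)

lemma app_wv: "app (T :: ('x, 'k::field) op) (wv w) = T w"
  by (simp add: app_def wv_def cong: if_cong)

lemma app_idm:
  fixes f :: "('x::finite, 'k::field) vec"
  assumes f: "deg m f"
  shows "app (idm m) f = f"
proof
  fix v
  have "app (idm m) f v = (\<Sum>w\<in>words m. if w = v then f v else 0)"
    unfolding app_words[OF f] by (intro sum.cong) (auto simp: idm_def wv_def)
  also have "\<dots> = f v" using f by (auto simp: deg_def)
  finally show "app (idm m) f v = f v" .
qed

lemma deg_app: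
  fixes T :: "('x, 'k::field) op"
  assumes "\<And>w. deg m (T w)"
  shows "deg m (app T f)"
  unfolding deg_def app_def
proof (intro allI impI)
  fix v assume "(\<Sum>w\<in>{w. f w \<noteq> 0}. f w * T w v) \<noteq> 0"
  then obtain w where "T w v \<noteq> 0" by (metis (no_types, lifting) mult_zero_right sum.neutral)
  then show "length v = m" using assms by (simp add: deg_def)
qed

lemma app_comp:
  fixes f :: "('x::finite, 'k::field) vec"
  assumes f: "deg m f" and U: "\<And>w. deg m (U w)"
  shows "app (comp T U) f = app T (app U f)"
proof
  fix v
  have "app (comp T U) f v = (\<Sum>w\<in>words m. \<Sum>u\<in>words m. f w * (U w u * T u v))"
    unfolding app_words[OF f] comp_def app_words[OF U] by (simp add: sum_distrib_left)
  also have "\<dots> = (\<Sum>u\<in>words m. \<Sum>w\<in>words m. f w * (U w u * T u v))" by (rule sum.swap)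
  also have "\<dots> = app T (app U f) v"
    unfolding app_words[OF deg_app[OF U]] app_words[OF f]
    by (simp add: sum_distrib_right mult.assoc)
  finally show "app (comp T U) f v = app T (app U f) v" .
qed

lemma app_alt_Suc:
  fixes f :: "('x::finite, 'k::field) vec"
  assumes "deg m f" "\<And>w. deg m (s w)"
  shows "app (alt m t s (Suc k)) f = app (alt m s t k) (app s f)"
  using app_comp[OF assms, of "alt m s t k"] by simp

lemma deg_alt:
  fixes s t :: "('x, 'k::field) op"
  assumes "\<And>w. deg m (s w)" "\<And>w. deg m (t w)"
  shows "deg m (alt m t s k w)"
  using assms
proof (induction k arbitrary: s t w)
  case 0
  then show ?case by (simp add: idm_def deg_wv deg_zero)
next
  case (Suc k)
  then show ?case by (simp add: comp_def deg_app)
qed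

lemma lead_app:
  fixes f :: "('x::{finite,linorder}, 'k::field) vec"
  assumes f: "deg m f" "lead f w" and T: "T w = wv w"
    and le: "\<And>u v. length u = m \<Longrightarrow> T u v \<noteq> 0 \<Longrightarrow> v \<le> u"
  shows "lead (app T f) w"
proof -
  have w: "length w = m" using f by (simp add: deg_def lead_def)
  have "f u * T u w = (if u = w then f w else 0)" if "length u = m" for u
    using f(2) le[OF that, of w] by (force simp: T wv_def lead_def)
  then have "app T f w = (\<Sum>u\<in>words m. if u = w then f w else 0)"
    unfolding app_words[OF f(1)] by (intro sum.cong) auto
  then have "app T f w = f w" using w by simp
  moreover have "v \<le> w" if "app T f v \<noteq> 0" for v
  proof -
    from that obtain u where "length u = m" "f u * T u v \<noteq> 0"
      unfolding app_words[OF f(1)] by (metis (no_types, lifting) sum.neutral words_iff)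
    then show ?thesis using f(2) le[of u v] unfolding lead_def by (auto intro: order.trans)
  qed
  ultimately show ?thesis using f(2) by (simp add: lead_def)
qed

text \<open>The common value of the two alternating products kills both subspaces, yet keeps the
  leading word of every vector whose leading word is fixed by both operators.\<close>

lemma confluent_if_alt_eq:
  fixes s t :: "('x::{finite,linorder}, 'k::field) op"
  assumes A: "subsp (words m) A" and B: "subsp (words m) B"
    and s: "\<And>w. deg m (s w)" "\<And>u v. length u = m \<Longrightarrow> s u v \<noteq> 0 \<Longrightarrow> v \<le> u"
      "\<And>w. length w = m \<Longrightarrow> w \<notin> leads A \<Longrightarrow> s w = wv w"
      "\<And>f. f \<in> A \<Longrightarrow> app s f = (\<lambda>_. 0)"
    and t: "\<And>w. deg m (t w)" "\<And>u v. length u = m \<Longrightarrow> t u v \<noteq> 0 \<Longrightarrow> v \<le> u"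
      "\<And>w. length w = m \<Longrightarrow> w \<notin> leads B \<Longrightarrow> t w = wv w"
      "\<And>f. f \<in> B \<Longrightarrow> app t f = (\<lambda>_. 0)"
    and eq: "alt m t s k = alt m s t k" and k: "k \<ge> 1"
  shows "confluent A B"
proof (rule confluent_if_leads_ssum[OF finite_words A B])
  obtain k' where k': "k = Suc k'" using k by (cases k) auto
  have lead_alt: "lead (app (alt m t s j) f) w"
    if "s w = wv w" "t w = wv w" "deg m f" "lead f w" for f w j
  proof -
    have "\<forall>f. deg m f \<longrightarrow> lead f w \<longrightarrow> lead (app (alt m t s j) f) w \<and> lead (app (alt m s t j) f) w"
    proof (induction j)
      case 0
      show ?case by (simp add: app_idm)
    next
      case (Suc j)
      show ?case
      proof (intro allI impI)
        fix f :: "('x, 'k) vec" assume f: "deg m f" "lead f w"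
        have "lead (app s f) w" by (rule lead_app[of m f w s, OF f that(1) s(2)])
        moreover have "lead (app t f) w" by (rule lead_app[of m f w t, OF f that(2) t(2)])
        ultimately show "lead (app (alt m t s (Suc j)) f) w \<and> lead (app (alt m s t (Suc j)) f) w"
          using Suc.IH deg_app[of m s f] deg_app[of m t f] s(1) t(1)
          unfolding app_alt_Suc[OF f(1) s(1)] app_alt_Suc[OF f(1) t(1)] by blast
      qed
    qed
    with that show ?thesis by blast
  qed
  show "leads (ssum A B) \<subseteq> leads A \<union> leads B"
  proof
    fix w assume "w \<in> leads (ssum A B)"
    then obtain a b where ab: "a \<in> A" "b \<in> B" and w: "lead (\<lambda>v. a v + b v) w"
      unfolding leads_def ssum_def by blast
    have da: "deg m a" and db: "deg m b" using ab subsp_deg[OF A] subsp_deg[OF B] by blast+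
    have d: "deg m (\<lambda>v. a v + b v)" using deg_lincomb[OF da db, of 1] by simp
    have "app (alt m t s k) (\<lambda>v. a v + b v)
        = (\<lambda>v. app (alt m t s k) a v + app (alt m t s k) b v)"
      using app_lincomb[OF da db, of "alt m t s k" 1] by simp
    also have "app (alt m t s k) a = (\<lambda>_. 0)"
      unfolding k' app_alt_Suc[OF da s(1)] s(4)[OF ab(1)] by (rule app_zero)
    also have "app (alt m t s k) b = (\<lambda>_. 0)"
      unfolding eq unfolding k' app_alt_Suc[OF db t(1)] t(4)[OF ab(2)] by (rule app_zero)
    finally have "\<not> lead (app (alt m t s k) (\<lambda>v. a v + b v)) w" by (simp add: lead_def)
    moreover have "length w = m" using w d by (simp add: lead_def deg_def)
    ultimately show "w \<in> leads A \<union> leads B"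
      using lead_alt[OF _ _ d w] s(3) t(3) by blast
  qed
qed

section \<open>Reduction operators\<close>

lemma reduction_opD:
  fixes T :: "('x::{finite,linorder}, 'k::field) op"
  assumes "reduction_op m T"
  shows "length w \<noteq> m \<Longrightarrow> T w = (\<lambda>_. 0)" "deg m (T w)" "app T (T w) = T w"
    "length w = m \<Longrightarrow> T w \<noteq> wv w \<Longrightarrow> T w v \<noteq> 0 \<Longrightarrow> v < w"
    "length w = m \<Longrightarrow> T w v \<noteq> 0 \<Longrightarrow> v \<le> w"
proof -
  show "length w \<noteq> m \<Longrightarrow> T w = (\<lambda>_. 0)" "deg m (T w)"
    using assms unfolding reduction_op_def by blast+
  show "app T (T w) = T w" using assms unfolding reduction_op_def comp_def by metis
  show *: "length w = m \<Longrightarrow> T w \<noteq> wv w \<Longrightarrow> T w v \<noteq> 0 \<Longrightarrow> v < w"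
    using assms unfolding reduction_op_def lexordp_iff_less by auto
  show "length w = m \<Longrightarrow> T w v \<noteq> 0 \<Longrightarrow> v \<le> w"
    using * by (cases "T w = wv w") (auto simp: wv_def split: if_splits intro: less_imp_le)
qed

lemma subsp_ker: "subsp (words m) (ker m (T :: ('x::finite, 'k::field) op))"
  unfolding subsp_def
proof (intro conjI ballI allI impI)
  show "(\<lambda>_. 0) \<in> ker m T" by (simp add: ker_def app_zero deg_zero)
  show "(\<lambda>v. f v + c * g v) \<in> ker m T" if "f \<in> ker m T" "g \<in> ker m T" for f g c
    using that app_lincomb[of m f g T c] by (simp add: ker_def deg_lincomb)
  show "v \<in> words m" if "f \<in> ker m T" "f v \<noteq> 0" for f v
    using that by (simp add: ker_def deg_def)
qed

lemma leads_ker: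
  fixes T :: "('x::{finite,linorder}, 'k::field) op"
  assumes T: "reduction_op m T"
  shows "leads (ker m T) = {w. length w = m \<and> T w \<noteq> wv w}"
proof (intro set_eqI iffI)
  fix w assume "w \<in> leads (ker m T)"
  then obtain f where f: "deg m f" "app T f = (\<lambda>_. 0)" "lead f w"
    unfolding leads_def ker_def by blast
  have "T w \<noteq> wv w"
    using lead_app[of m f w T, OF f(1,3) _ reduction_opD(5)[OF T]] f(2) by (auto simp: lead_def)
  with f show "w \<in> {w. length w = m \<and> T w \<noteq> wv w}" by (simp add: lead_def deg_def)
next
  fix w assume w: "w \<in> {w. length w = m \<and> T w \<noteq> wv w}"
  let ?f = "\<lambda>v. wv w v + (-1) * T w v"
  have d: "deg m (wv w)" using w by (simp add: deg_wv)
  have "app T ?f = (\<lambda>v. app T (wv w) v + (-1) * app T (T w) v)"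
    using d reduction_opD(2)[OF T] by (rule app_lincomb)
  then have "?f \<in> ker m T"
    using deg_lincomb[OF d reduction_opD(2)[OF T], of "-1" w]
    by (simp add: ker_def reduction_opD(3)[OF T] app_wv)
  moreover have "v < w" if "T w v \<noteq> 0" for v
    using reduction_opD(4)[OF T] w that by blast
  then have "T w w = 0" "\<And>v. T w v \<noteq> 0 \<Longrightarrow> v \<le> w" by (blast intro: less_imp_le)+
  then have "lead ?f w" unfolding lead_def wv_def by (auto split: if_splits)
  ultimately show "w \<in> leads (ker m T)" unfolding leads_def by blast
qed

lemma reduction_op_image:
  fixes T :: "('x::{finite,linorder}, 'k::field) op"
  assumes T: "reduction_op m T" and "T w u \<noteq> 0"
  shows "T u = wv u"
proof (rule ccontr)
  assume "T u \<noteq> wv u"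
  let ?U = "{u. length u = m \<and> T w u \<noteq> 0 \<and> T u \<noteq> wv u}"
  have "finite ?U" by (rule finite_subset[of _ "words m"]) auto
  moreover have "u \<in> ?U"
    using assms(2) reduction_opD(2)[OF T, of w] \<open>T u \<noteq> wv u\<close> by (simp add: deg_def)
  ultimately obtain x where x: "x \<in> ?U" and max: "\<forall>v\<in>?U. v \<le> x"
    using Max_in[of ?U] Max_ge[of ?U] by blast
  have "T w v * T v x = 0" if v: "length v = m" for v
  proof (rule ccontr)
    assume nz: "T w v * T v x \<noteq> 0"
    show False
    proof (cases "T v = wv v")
      case True
      then have "v = x" using nz by (auto simp: wv_def split: if_splits)
      with True x show False by blast
    next
      case False
      then have "v \<le> x" using max v nz by simp
      moreover have "x < v" using reduction_opD(4)[OF T v False] nz by simp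
      ultimately show False by simp
    qed
  qed
  then have "app T (T w) x = 0"
    unfolding app_words[OF reduction_opD(2)[OF T]] by (intro sum.neutral) simp
  with x show False by (simp add: reduction_opD(3)[OF T])
qed

definition nform :: "nat \<Rightarrow> ('x::linorder, 'k::field) vec set \<Rightarrow> ('x, 'k) vec \<Rightarrow> ('x, 'k) vec \<Rightarrow> bool" where
  "nform m W f g \<longleftrightarrow> deg m g \<and> (\<lambda>v. f v - g v) \<in> W \<and> (\<forall>u\<in>leads W. g u = 0)"

lemma nform_unique:
  fixes f :: "('x::{finite,linorder}, 'k::field) vec"
  assumes W: "subsp (words m) W" and g: "nform m W f g" and h: "nform m W f h"
  shows "g = h"
proof (rule ccontr)
  assume "g \<noteq> h"
  let ?d = "\<lambda>v. (f v - g v) - (f v - h v)"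
  have d: "?d \<in> W"
    by (rule subsp_diff[OF W]) (use g h in \<open>simp_all add: nform_def\<close>)
  have "?d \<noteq> (\<lambda>_. 0)" using \<open>g \<noteq> h\<close> by (auto simp: fun_eq_iff) metis
  then obtain w where w: "lead ?d w"
    using lead_ex[OF finite_words, of ?d m] subsp_supp[OF W d] by blast
  then have "w \<in> leads W" using d unfolding leads_def by blast
  then have "?d w = 0" using g h unfolding nform_def by simp
  with w show False by (simp add: lead_def)
qed

lemma nform_ex:
  fixes f :: "('x::{finite,linorder}, 'k::field) vec"
  assumes W: "subsp (words m) W" and f: "deg m f"
  shows "\<exists>g. nform m W f g \<and> (\<forall>v. g v \<noteq> 0 \<longrightarrow> (\<exists>u. f u \<noteq> 0 \<and> v \<le> u))"
proof -
  have "\<forall>v. f v \<noteq> 0 \<longrightarrow> v \<in> words m" using f by (simp add: deg_def)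
  with finite_words show ?thesis
  proof (induction f rule: vec_induct)
    case (less f)
    show ?case
    proof (cases "f = (\<lambda>_. 0)")
      case True
      then show ?thesis using subsp_zero[OF W]
        by (intro exI[of _ "\<lambda>_. 0"]) (simp add: nform_def deg_zero)
    next
      case False
      then obtain w where w: "lead f w" "length w = m"
        using lead_ex[OF finite_words less.hyps] by auto
      have fw: "f w \<noteq> 0" and fle: "\<And>v. f v \<noteq> 0 \<Longrightarrow> v \<le> w" using w by (auto simp: lead_def)
      show ?thesis
      proof (cases "w \<in> leads W")
        case True
        then obtain h where h: "h \<in> W" "lead h w" unfolding leads_def by blast
        let ?f = "\<lambda>v. f v - f w / h w * h v"
        have lt: "\<forall>v. ?f v \<noteq> 0 \<longrightarrow> v \<in> words m \<and> v < w"
          using cancel_lead[OF w(1) h(2)] less.hyps subsp_supp[OF W h(1)]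
          by (metis diff_0_right mult_zero_right)
        obtain g where g: "nform m W ?f g" "\<forall>v. g v \<noteq> 0 \<longrightarrow> (\<exists>u. ?f u \<noteq> 0 \<and> v \<le> u)"
          using less.IH[OF w(1) lt] by blast
        have "(\<lambda>v. (?f v - g v) + f w / h w * h v) \<in> W"
          using g(1) h unfolding nform_def by (intro subsp_lincomb[OF W]) auto
        moreover have "(\<lambda>v. (?f v - g v) + f w / h w * h v) = (\<lambda>v. f v - g v)" by (rule ext) simp
        ultimately have "nform m W f g" using g(1) unfolding nform_def by (simp only:) simp
        moreover have "v \<le> w" if "g v \<noteq> 0" for v
          using g(2) lt that by (meson less_imp_le order.trans)
        ultimately show ?thesis using fw by blast
      next
        case False
        let ?f = "\<lambda>v. if v = w then 0 else f v"
        have lt: "\<forall>v. ?f v \<noteq> 0 \<longrightarrow> v \<in> words m \<and> v < w"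
          using fle less.hyps by (simp add: order.strict_iff_order)
        obtain g where g: "nform m W ?f g" "\<forall>v. g v \<noteq> 0 \<longrightarrow> (\<exists>u. ?f u \<noteq> 0 \<and> v \<le> u)"
          using less.IH[OF w(1) lt] by blast
        let ?g = "\<lambda>v. g v + f w * wv w v"
        have "(\<lambda>v. f v - ?g v) = (\<lambda>v. ?f v - g v)" by (rule ext) (simp add: wv_def)
        moreover have "deg m ?g" using g(1) w unfolding nform_def by (intro deg_lincomb deg_wv) auto
        ultimately have "nform m W f ?g"
          using g(1) False unfolding nform_def by (auto simp: wv_def)
        moreover have "v \<le> w" if "?g v \<noteq> 0" for v
          using g(2) lt that by (cases "v = w") (auto simp: wv_def, meson less_imp_le order.trans)
        ultimately show ?thesis using fw by blast
      qed
    qed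
  qed
qed

lemma reduction_op_nform:
  fixes T :: "('x::{finite,linorder}, 'k::field) op"
  assumes T: "reduction_op m T" and w: "length w = m"
  shows "nform m (ker m T) (wv w) (T w)"
  unfolding nform_def
proof (intro conjI ballI)
  show "deg m (T w)" by (rule reduction_opD(2)[OF T])
  have d: "deg m (wv w)" using w by (rule deg_wv)
  have "app T (\<lambda>v. wv w v + (-1) * T w v) = (\<lambda>v. app T (wv w) v + (-1) * app T (T w) v)"
    using d reduction_opD(2)[OF T] by (rule app_lincomb)
  then show "(\<lambda>v. wv w v - T w v) \<in> ker m T"
    using deg_lincomb[OF d reduction_opD(2)[OF T], of "-1" w]
    by (simp add: ker_def reduction_opD(3)[OF T] app_wv)
  show "T w u = 0" if "u \<in> leads (ker m T)" for u
    using reduction_op_image[OF T] that leads_ker[OF T] by blast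
qed

lemma reduction_op_unique:
  fixes S T :: "('x::{finite,linorder}, 'k::field) op"
  assumes S: "reduction_op m S" and T: "reduction_op m T" and ker: "ker m S = ker m T"
  shows "S = T"
proof
  fix w
  show "S w = T w"
  proof (cases "length w = m")
    case True
    with reduction_op_nform[OF S True] reduction_op_nform[OF T True] ker show ?thesis
      using nform_unique[OF subsp_ker] by metis
  next
    case False
    then show ?thesis using reduction_opD(1)[OF S] reduction_opD(1)[OF T] by simp
  qed
qed

lemma reduction_op_ex:
  fixes W :: "('x::{finite,linorder}, 'k::field) vec set"
  assumes W: "subsp (words m) W"
  shows "\<exists>T. reduction_op m T \<and> ker m T = W"
proof -
  define T :: "('x, 'k) op" where
    "T w = (if length w = m then THE g. nform m W (wv w) g else (\<lambda>_. 0))" for w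
  have T: "nform m W (wv w) g \<Longrightarrow> T w = g" if "length w = m" for w g
    unfolding T_def using that nform_unique[OF W, of "wv w"] by (auto intro!: the_equality)
  have Tn: "nform m W (wv w) (T w)" if "length w = m" for w
    using nform_ex[OF W deg_wv[OF that]] T[OF that] by metis
  have degT: "deg m (T w)" for w
    using Tn[of w] by (cases "length w = m") (auto simp: nform_def T_def deg_zero)
  have appT: "nform m W f (app T f)" if f: "deg m f" for f
    unfolding nform_def
  proof (intro conjI ballI)
    show "deg m (app T f)" using degT by (rule deg_app)
    have "(\<lambda>v. \<Sum>w\<in>words m. f w * (\<lambda>w v. wv w v - T w v) w v) \<in> W"
      using Tn by (intro subsp_sum[OF finite_words W]) (simp add: nform_def)
    moreover have "(\<Sum>w\<in>words m. f w * wv w v) = f v" for v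
    proof -
      have "(\<Sum>w\<in>words m. f w * wv w v) = (\<Sum>w\<in>words m. if w = v then f v else 0)"
        by (intro sum.cong) (auto simp: wv_def)
      also have "\<dots> = f v" using f by (auto simp: deg_def)
      finally show ?thesis .
    qed
    then have "(\<lambda>v. \<Sum>w\<in>words m. f w * (\<lambda>w v. wv w v - T w v) w v) = (\<lambda>v. f v - app T f v)"
      by (simp add: app_words[OF f] right_diff_distrib sum_subtractf)
    ultimately show "(\<lambda>v. f v - app T f v) \<in> W" by simp
    show "app T f u = 0" if "u \<in> leads W" for u
      unfolding app_words[OF f] using Tn that by (intro sum.neutral) (auto simp: nform_def)
  qed
  have red: "reduction_op m T"
    unfolding reduction_op_def
  proof (intro conjI allI impI ballI)
    show "T w = (\<lambda>_. 0)" if "length w \<noteq> m" for w using that by (simp add: T_def)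
    show "deg m (T w)" for w by (rule degT)
    show "comp T T = T"
    proof
      fix w
      show "comp T T w = T w"
      proof (cases "length w = m")
        case True
        have "nform m W (T w) (T w)"
          using Tn[OF True] subsp_zero[OF W] by (simp add: nform_def)
        then show ?thesis
          using nform_unique[OF W appT[OF degT]] by (simp add: comp_def)
      next
        case False
        then show ?thesis by (simp add: comp_def T_def app_zero)
      qed
    qed
    fix w :: "'x list" assume "w \<in> words m"
    then have w: "length w = m" by simp
    show "T w = wv w \<or> (\<forall>v. T w v \<noteq> 0 \<longrightarrow> lexordp (<) v w)"
    proof (cases "w \<in> leads W")
      case True
      obtain g where g: "nform m W (wv w) g" "\<forall>v. g v \<noteq> 0 \<longrightarrow> (\<exists>u. wv w u \<noteq> (0::'k) \<and> v \<le> u)"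
        using nform_ex[OF W deg_wv[OF w]] by blast
      have "v < w" if "T w v \<noteq> 0" for v
      proof -
        have "v \<le> w" using g T[OF w g(1)] that by (auto simp: wv_def split: if_splits)
        moreover have "v \<noteq> w" using Tn[OF w] True that by (auto simp: nform_def)
        ultimately show ?thesis by simp
      qed
      then show ?thesis by (simp add: lexordp_iff_less)
    next
      case False
      then have "nform m W (wv w) (wv w)"
        using w subsp_zero[OF W] deg_wv[OF w] by (auto simp: nform_def) (auto simp: wv_def)
      then show ?thesis using T[OF w] by blast
    qed
  qed
  have "ker m T = W"
  proof (intro set_eqI iffI)
    fix f assume "f \<in> ker m T"
    then show "f \<in> W" using appT[of f] by (simp add: ker_def nform_def)
  next
    fix f assume f: "f \<in> W"
    then have "nform m W f (\<lambda>_. 0)" by (simp add: nform_def deg_zero)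
    then show "f \<in> ker m T"
      using nform_unique[OF W appT[OF subsp_deg[OF W f]]] subsp_deg[OF W f] by (simp add: ker_def)
  qed
  with red show ?thesis by blast
qed

lemma theta_inv:
  fixes W :: "('x::{finite,linorder}, 'k::field) vec set"
  assumes W: "subsp (words m) W"
  shows "reduction_op m (theta_inv m W)" "ker m (theta_inv m W) = W"
proof -
  have "\<exists>!T. reduction_op m T \<and> ker m T = W"
    using reduction_op_ex[OF W] reduction_op_unique by metis
  from theI'[OF this] show "reduction_op m (theta_inv m W)" "ker m (theta_inv m W) = W"
    unfolding theta_inv_def by blast+
qed

lemma reduction_op_idm: "reduction_op m (idm m :: ('x::{finite,linorder}, 'k::field) op)"
  unfolding reduction_op_def
proof (intro conjI allI impI ballI)
  show "deg m (idm m w :: ('x, 'k) vec)" for w by (simp add: idm_def deg_wv deg_zero)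
  then show "comp (idm m) (idm m) = (idm m :: ('x, 'k) op)"
    unfolding comp_def by (simp add: app_idm)
qed (auto simp: idm_def)

lemma ker_idm: "ker m (idm m :: ('x::{finite,linorder}, 'k::field) op) = {\<lambda>_. 0}"
  unfolding ker_def using app_idm deg_zero by (auto simp: app_zero)

text \<open>Alternately applying s and t terminates on vectors supported by words fixed by both, and
  confluence makes the two outcomes agree.\<close>

lemma alt_eq_if_confluent:
  fixes s t :: "('x::{finite,linorder}, 'k::field) op"
  assumes s: "reduction_op m s" and t: "reduction_op m t" and confluent: "confluent (ker m s) (ker m t)"
  shows "\<exists>k\<ge>1. alt m s t k = alt m t s k"
proof -
  let ?A = "ker m s" and ?B = "ker m t"
  let ?S = "ssum ?A ?B"
  define fixed where "fixed v \<longleftrightarrow> s v = wv v \<and> t v = wv v" for v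
  note ds = reduction_opD(2)[OF s] and dt = reduction_opD(2)[OF t]
  have S: "subsp (words m) ?S" by (intro subsp_ssum subsp_ker)
  have norm: "\<exists>k0. \<forall>k\<ge>k0. \<forall>v. (alt m s t k w v \<noteq> 0 \<longrightarrow> fixed v) \<and> (alt m t s k w v \<noteq> 0 \<longrightarrow> fixed v)"
    if "w \<in> words m" for w
    using finite_words that
  proof (induction w rule: finite_less_induct)
    case (less w)
    then have w: "length w = m" by simp
    have lower: "\<exists>k0. \<forall>k\<ge>k0. \<forall>v. (app (alt m s t k) f v \<noteq> 0 \<longrightarrow> fixed v)
        \<and> (app (alt m t s k) f v \<noteq> 0 \<longrightarrow> fixed v)"
      if f: "deg m f" "\<And>v. f v \<noteq> 0 \<Longrightarrow> v < w" for f
    proof -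
      have "\<forall>u. \<exists>k0. f u \<noteq> 0 \<longrightarrow> (\<forall>k\<ge>k0. \<forall>v. (alt m s t k u v \<noteq> 0 \<longrightarrow> fixed v)
          \<and> (alt m t s k u v \<noteq> 0 \<longrightarrow> fixed v))"
        using less.IH f by (metis deg_def words_iff)
      then obtain K where K: "\<And>u k v. f u \<noteq> 0 \<Longrightarrow> k \<ge> K u \<Longrightarrow>
          (alt m s t k u v \<noteq> 0 \<longrightarrow> fixed v) \<and> (alt m t s k u v \<noteq> 0 \<longrightarrow> fixed v)" by metis
      have "fixed v" if k: "k \<ge> Max (K ` words m)" and
        nz: "app (alt m s t k) f v \<noteq> 0 \<or> app (alt m t s k) f v \<noteq> 0" for k v
      proof -
        have "\<exists>u\<in>words m. f u * alt m s t k u v \<noteq> 0 \<or> f u * alt m t s k u v \<noteq> 0"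
          using nz unfolding app_words[OF f(1)] by (metis (no_types, lifting) sum.neutral)
        then obtain u where u: "u \<in> words m" "f u \<noteq> 0" "alt m s t k u v \<noteq> 0 \<or> alt m t s k u v \<noteq> 0"
          by auto
        have "K u \<le> Max (K ` words m)" using u(1) by (intro Max_ge finite_imageI finite_words imageI)
        then show ?thesis using K[OF u(2), of k v] u(3) k by linarith
      qed
      then show ?thesis by blast
    qed
    have st: "alt m s t (Suc k) w = app (alt m t s k) (t w)"
      and ts: "alt m t s (Suc k) w = app (alt m s t k) (s w)" for k
      by (simp_all add: comp_def)
    show ?case
    proof (cases "s w = wv w")
      case True
      note sw = True
      show ?thesis
      proof (cases "t w = wv w")
        case True
        have "alt m s t k w = wv w \<and> alt m t s k w = wv w" for k
          by (induction k) (use w sw True in \<open>auto simp: idm_def comp_def app_wv\<close>)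
        then show ?thesis using sw True by (auto simp: fixed_def wv_def split: if_splits)
      next
        case False
        obtain k0 where k0: "\<forall>k\<ge>k0. \<forall>v. (app (alt m s t k) (t w) v \<noteq> 0 \<longrightarrow> fixed v)
            \<and> (app (alt m t s k) (t w) v \<noteq> 0 \<longrightarrow> fixed v)"
          using lower[OF dt reduction_opD(4)[OF t w False]] by blast
        have "(alt m s t k w v \<noteq> 0 \<longrightarrow> fixed v) \<and> (alt m t s k w v \<noteq> 0 \<longrightarrow> fixed v)"
          if "k \<ge> Suc (Suc k0)" for k v
        proof -
          define j where "j = k - 2"
          have j: "k = Suc (Suc j)" "j \<ge> k0" using that by (auto simp: j_def)
          have "k \<ge> k0" "Suc j \<ge> k0" using j by auto
          then show ?thesis using k0 j(2) unfolding j(1) st[of "Suc j"] ts[of "Suc j"] sw app_wv st[of j]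
            by blast
        qed
        then show ?thesis by blast
      qed
    next
      case False
      obtain k0 where k0: "\<forall>k\<ge>k0. \<forall>v. (app (alt m s t k) (s w) v \<noteq> 0 \<longrightarrow> fixed v)
          \<and> (app (alt m t s k) (s w) v \<noteq> 0 \<longrightarrow> fixed v)"
        using lower[OF ds reduction_opD(4)[OF s w False]] by blast
      obtain k1 where k1: "t w \<noteq> wv w \<Longrightarrow> \<forall>k\<ge>k1. \<forall>v. (app (alt m s t k) (t w) v \<noteq> 0 \<longrightarrow> fixed v)
          \<and> (app (alt m t s k) (t w) v \<noteq> 0 \<longrightarrow> fixed v)"
        using lower[OF dt reduction_opD(4)[OF t w]] by blast
      have "(alt m s t k w v \<noteq> 0 \<longrightarrow> fixed v) \<and> (alt m t s k w v \<noteq> 0 \<longrightarrow> fixed v)"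
        if "k \<ge> Suc (Suc (k0 + k1))" for k v
      proof -
        define j where "j = k - 2"
        have j: "k = Suc (Suc j)" "j \<ge> k0" "j \<ge> k1" using that by (auto simp: j_def)
        have "alt m t s k w v \<noteq> 0 \<longrightarrow> fixed v"
          using k0[rule_format, OF le_SucI[OF j(2)], of v] unfolding j(1) ts[of "Suc j"] by blast
        moreover have "alt m s t k w v \<noteq> 0 \<longrightarrow> fixed v"
        proof (cases "t w = wv w")
          case True
          show ?thesis using k0 j(2) unfolding j(1) st[of "Suc j"] True app_wv ts[of j] by blast
        next
          case False
          show ?thesis using k1[OF False, rule_format, OF le_SucI[OF j(3)], of v] unfolding j(1) st[of "Suc j"] by blast
        qed
        ultimately show ?thesis by blast
      qed
      then show ?thesis by blast
    qed
  qed
  have step: "(\<lambda>v. f v - app s f v) \<in> ?S \<and> (\<lambda>v. f v - app t f v) \<in> ?S" if f: "deg m f" for f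
  proof -
    have *: "(\<lambda>v. f v - app T f v) \<in> ker m T" if T: "reduction_op m T" for T
    proof -
      note dT = reduction_opD(2)[OF T]
      have "app T (app T f) = app (comp T T) f" by (rule app_comp[OF f dT, symmetric])
      also have "comp T T = T" using T by (simp add: reduction_op_def)
      finally show ?thesis
        using app_lincomb[OF f deg_app[of m T f], of T "-1"] deg_lincomb[OF f deg_app[of m T f], of "-1"] dT
        by (simp add: ker_def)
    qed
    show ?thesis using *[OF s] *[OF t] ssum_upper1[OF subsp_ker, of ?A m t]
      ssum_upper2[OF subsp_ker, of ?B m s] by (simp add: subset_iff)
  qed
  have cong: "(\<lambda>v. f v - app (alt m s t k) f v) \<in> ?S \<and> (\<lambda>v. f v - app (alt m t s k) f v) \<in> ?S"
    if f: "deg m f" for f k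
    using f
  proof (induction k arbitrary: f)
    case 0
    then show ?case by (simp add: app_idm subsp_zero[OF S])
  next
    case (Suc k)
    have ss: "(\<lambda>v. (f v - app s f v) + (app s f v - app (alt m s t k) (app s f) v)) \<in> ?S"
      by (rule subsp_add[OF S])
        (use step[OF Suc.prems] Suc.IH[OF deg_app[of m s f, OF ds]] in \<open>simp_all\<close>)
    have tt: "(\<lambda>v. (f v - app t f v) + (app t f v - app (alt m t s k) (app t f) v)) \<in> ?S"
      by (rule subsp_add[OF S])
        (use step[OF Suc.prems] Suc.IH[OF deg_app[of m t f, OF dt]] in \<open>simp_all\<close>)
    show ?case using ss tt
      unfolding app_alt_Suc[OF Suc.prems ds] app_alt_Suc[OF Suc.prems dt] by simp
  qed
  obtain K where K: "\<And>w k v. w \<in> words m \<Longrightarrow> k \<ge> K w \<Longrightarrow>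
      (alt m s t k w v \<noteq> 0 \<longrightarrow> fixed v) \<and> (alt m t s k w v \<noteq> 0 \<longrightarrow> fixed v)"
    using norm by metis
  define k where "k = Suc (Max (K ` words m))"
  have "alt m s t k w = alt m t s k w" for w
  proof (cases "length w = m")
    case True
    let ?d = "\<lambda>v. (wv w v - alt m t s k w v) - (wv w v - alt m s t k w v)"
    have "K w \<le> Max (K ` words m)" using True by (intro Max_ge) auto
    then have k: "k \<ge> K w" unfolding k_def by simp
    have d: "?d \<in> ?S"
      by (rule subsp_diff[OF S]) (use cong[OF deg_wv[OF True], of k] in \<open>simp_all add: app_wv\<close>)
    show ?thesis
    proof (rule ccontr)
      assume "alt m s t k w \<noteq> alt m t s k w"
      then have "?d \<noteq> (\<lambda>_. 0)" by (auto simp: fun_eq_iff)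
      then obtain u where u: "lead ?d u"
        using lead_ex[OF finite_words, of ?d m] subsp_supp[OF S d] by blast
      then have "alt m s t k w u \<noteq> 0 \<or> alt m t s k w u \<noteq> 0" by (auto simp: lead_def)
      then have "fixed u" using K[of w k u] k True by auto
      moreover have "u \<in> leads ?A \<union> leads ?B"
        using u d leads_ssum[OF finite_words subsp_ker subsp_ker confluent] unfolding leads_def by blast
      ultimately show False unfolding leads_ker[OF s] leads_ker[OF t] fixed_def by blast
    qed
  next
    case False
    then show ?thesis using reduction_opD(1)[OF s] reduction_opD(1)[OF t]
      by (simp add: k_def comp_def app_zero)
  qed
  then show ?thesis by (intro exI[of _ k]) (auto simp: k_def)
qed

section \<open>Extending subspaces to larger degree\<close>

text \<open>If A is a subspace of degree n, then extend a n b A is the tensor product of A with all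
  vectors of degree a on the left and all vectors of degree b on the right.\<close>

definition extend :: "nat \<Rightarrow> nat \<Rightarrow> nat \<Rightarrow> ('x, 'k::zero) vec set \<Rightarrow> ('x, 'k) vec set" where
  "extend a n b A = {f. deg (a + n + b) f \<and>
     (\<forall>p s. length p = a \<longrightarrow> length s = b \<longrightarrow> (\<lambda>u. f (p @ u @ s)) \<in> A)}"

lemma subsp_extend:
  assumes A: "subsp (words n) A"
  shows "subsp (words (a + n + b)) (extend a n b A)"
  unfolding subsp_def
proof (intro conjI ballI allI impI)
  show "(\<lambda>_. 0) \<in> extend a n b A" by (simp add: extend_def deg_zero subsp_zero[OF A])
  show "(\<lambda>v. f v + c * g v) \<in> extend a n b A" if "f \<in> extend a n b A" "g \<in> extend a n b A" for f g c
    using that subsp_lincomb[OF A, of "\<lambda>u. f (p @ u @ s)" "\<lambda>u. g (p @ u @ s)" c for p s]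
    by (simp add: extend_def deg_lincomb)
  show "v \<in> words (a + n + b)" if "f \<in> extend a n b A" "f v \<noteq> 0" for f v
    using that by (simp add: extend_def deg_def)
qed

lemma extend_Int: "extend a n b (A \<inter> B) = extend a n b A \<inter> extend a n b B"
  unfolding extend_def by blast

lemma extend_INT: "I \<noteq> {} \<Longrightarrow> extend a n b (\<Inter>i\<in>I. E i) = (\<Inter>i\<in>I. extend a n b (E i))"
  unfolding extend_def by blast

lemma extend_mono: "A \<subseteq> B \<Longrightarrow> extend a n b A \<subseteq> extend a n b B"
  unfolding extend_def by blast

lemma extend_Vm: "extend a n b (Vm n) = Vm (a + n + b)"
proof -
  have "deg n (\<lambda>u. f (p @ u @ s))" if "deg (a + n + b) f" "length p = a" "length s = b"
    for f :: "('x, 'k::zero) vec" and p s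
    unfolding deg_def
  proof (intro allI impI)
    fix u assume "f (p @ u @ s) \<noteq> 0"
    then have "length (p @ u @ s) = a + n + b" using that(1) unfolding deg_def by blast
    then show "length u = n" using that by simp
  qed
  then show ?thesis by (auto simp: extend_def Vm_def)
qed

lemma extend_extend: "extend a (i + n + j) b (extend i n j A) = extend (a + i) n (j + b) A"
proof (intro set_eqI iffI)
  fix f assume f: "f \<in> extend a (i + n + j) b (extend i n j A)"
  have "(\<lambda>u. f (p @ u @ s)) \<in> A" if "length p = a + i" "length s = j + b" for p s
  proof -
    have "(\<lambda>u. f (take a p @ u @ drop j s)) \<in> extend i n j A" using f that by (simp add: extend_def)
    then have "(\<lambda>u. f (take a p @ (drop a p @ u @ take j s) @ drop j s)) \<in> A"
      using that unfolding extend_def by (simp del: append_assoc)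
    moreover have "take a p @ (drop a p @ u @ take j s) @ drop j s = p @ u @ s" for u
      by (simp only: append_assoc append_take_drop_id) (simp only: append_assoc[symmetric] append_take_drop_id)
    ultimately show ?thesis by (simp only:)
  qed
  with f show "f \<in> extend (a + i) n (j + b) A" by (simp add: extend_def add.assoc)
next
  fix f assume f: "f \<in> extend (a + i) n (j + b) A"
  have "(\<lambda>u. f (p @ u @ s)) \<in> extend i n j A" if ps: "length p = a" "length s = b" for p s
  proof -
    have "deg (i + n + j) (\<lambda>u. f (p @ u @ s))"
      using f ps unfolding extend_def deg_def by auto
    moreover have "(\<lambda>u. f (p @ (p' @ u @ s') @ s)) \<in> A" if "length p' = i" "length s' = j" for p' s'
    proof -
      have "(\<lambda>u. f ((p @ p') @ u @ (s' @ s))) \<in> A"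
        using f that ps unfolding extend_def by (simp del: append_assoc)
      then show ?thesis by simp
    qed
    ultimately show ?thesis by (simp add: extend_def)
  qed
  with f show "f \<in> extend a (i + n + j) b (extend i n j A)" by (simp add: extend_def add.assoc)
qed

lemma append_less_left:
  fixes u v :: "'x::linorder list"
  shows "u < v \<Longrightarrow> length u = length v \<Longrightarrow> u @ s < v @ s'"
  unfolding list_less_def by (rule lexord_sufI) simp_all

lemma append_less_right:
  fixes u v :: "'x::linorder list"
  shows "u < v \<Longrightarrow> p @ u < p @ v"
  unfolding list_less_def by (rule lexord_append_leftI)

lemma append_le_mono:
  fixes u v :: "'x::linorder list"
  assumes "u \<le> v" "length u = length v" "s \<le> s'"
  shows "u @ s \<le> v @ s'"
  using assms append_less_left[of u v s s'] append_less_right[of s s' u]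
  by (auto simp: order.order_iff_strict)

lemma sandwich_le_iff:
  fixes u v :: "'x::linorder list"
  assumes "length u = length v"
  shows "p @ u @ s \<le> p @ v @ s \<longleftrightarrow> u \<le> v"
proof
  show "p @ u @ s \<le> p @ v @ s" if "u \<le> v"
    using append_le_mono[OF that assms order.refl] by (rule append_le_mono[OF order.refl refl])
  show "u \<le> v" if "p @ u @ s \<le> p @ v @ s"
  proof (rule ccontr)
    assume "\<not> u \<le> v"
    then have "p @ v @ s < p @ u @ s"
      using assms by (intro append_less_right append_less_left) auto
    with that show False by simp
  qed
qed

lemma leads_extend:
  fixes A :: "('x::{finite,linorder}, 'k::field) vec set"
  assumes A: "subsp (words n) A"
  shows "leads (extend a n b A) = {p @ u @ s | p u s. length p = a \<and> length s = b \<and> u \<in> leads A}"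
proof (intro set_eqI iffI)
  fix w assume "w \<in> leads (extend a n b A)"
  then obtain f where f: "f \<in> extend a n b A" "lead f w" unfolding leads_def by blast
  then have w: "length w = a + n + b" by (auto simp: extend_def deg_def lead_def)
  define p u s where "p = take a w" and "u = take n (drop a w)" and "s = drop (a + n) w"
  have len: "length p = a" "length u = n" "length s = b" and wpus: "w = p @ u @ s"
    using w by (simp_all add: p_def u_def s_def add.commute[of a n]
        append_take_drop_id drop_drop[symmetric] del: drop_drop)
  have g: "(\<lambda>u. f (p @ u @ s)) \<in> A" using f(1) len by (simp add: extend_def)
  have "v \<le> u" if "f (p @ v @ s) \<noteq> 0" for v
  proof -
    have "length v = length u" using subsp_supp[OF A g that] len by simp
    moreover have "p @ v @ s \<le> p @ u @ s" using f(2) that unfolding lead_def wpus by blast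
    ultimately show ?thesis by (simp add: sandwich_le_iff)
  qed
  then have "lead (\<lambda>u. f (p @ u @ s)) u" using f(2) unfolding lead_def wpus by blast
  then show "w \<in> {p @ u @ s | p u s. length p = a \<and> length s = b \<and> u \<in> leads A}"
    using g len wpus unfolding leads_def by blast
next
  fix w assume "w \<in> {p @ u @ s | p u s. length p = a \<and> length s = b \<and> u \<in> leads A}"
  then obtain p u s f where w: "w = p @ u @ s" "length p = a" "length s = b"
    and f: "f \<in> A" "lead f u" unfolding leads_def by blast
  have u: "length u = n" using subsp_supp[OF A f(1)] f(2) by (simp add: lead_def)
  let ?h = "\<lambda>v. if length v = a + n + b \<and> take a v = p \<and> drop (a + n) v = s
    then f (take n (drop a v)) else 0"
  have "(\<lambda>v. ?h (p' @ v @ s')) \<in> A" if "length p' = a" "length s' = b" for p' s'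
  proof -
    have "(\<lambda>v. ?h (p' @ v @ s')) = (\<lambda>v. (if p' = p \<and> s' = s then 1 else 0) * f v)"
    proof
      fix v
      show "?h (p' @ v @ s') = (if p' = p \<and> s' = s then 1 else 0) * f v"
      proof (cases "length v = n")
        case True
        with that w(2,3) show ?thesis by auto
      next
        case False
        then have "f v = 0" using subsp_supp[OF A f(1)] by fastforce
        with False that show ?thesis by simp
      qed
    qed
    then show ?thesis using subsp_scale[OF A f(1)] by (simp only:)
  qed
  moreover have "deg (a + n + b) ?h" by (simp add: deg_def)
  ultimately have "?h \<in> extend a n b A" by (simp add: extend_def)
  moreover have "v \<le> w" if "?h v \<noteq> 0" for v
  proof -
    have v: "length v = a + n + b" "take a v = p" "drop (a + n) v = s" "f (take n (drop a v)) \<noteq> 0"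
      using that by (auto split: if_splits)
    have "v = take a v @ take n (drop a v) @ drop n (drop a v)" by (simp only: append_take_drop_id)
    then have "v = p @ take n (drop a v) @ s" using v by (simp add: add.commute)
    moreover have "p @ take n (drop a v) @ s \<le> p @ u @ s"
      using f(2) v u by (subst sandwich_le_iff) (auto simp: lead_def)
    ultimately show ?thesis using w by simp
  qed
  moreover have "?h w \<noteq> 0" using w u f(2) by (simp add: lead_def)
  ultimately have "lead ?h w" "?h \<in> extend a n b A" unfolding lead_def by blast+
  then show "w \<in> leads (extend a n b A)" unfolding leads_def by blast
qed

lemma confluent_extend:
  fixes A B :: "('x::{finite,linorder}, 'k::field) vec set"
  assumes A: "subsp (words n) A" and B: "subsp (words n) B" and confluent: "confluent A B"
  shows "confluent (extend a n b A) (extend a n b B)"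
  unfolding confluent_def
proof
  fix w assume w: "w \<in> leads (extend a n b A) \<inter> leads (extend a n b B)"
  obtain p u s where 1: "w = p @ u @ s" "length p = a" "length s = b" "u \<in> leads A"
    using w unfolding leads_extend[OF A] by blast
  obtain p' u' s' where 2: "w = p' @ u' @ s'" "length p' = a" "length s' = b" "u' \<in> leads B"
    using w unfolding leads_extend[OF B] by blast
  have "u = u'" using 1 2 leads_sub[OF A] leads_sub[OF B] by (auto simp: append_eq_append_conv)
  with 1 2 confluent have "u \<in> leads (A \<inter> B)" unfolding confluent_def by blast
  with 1 show "w \<in> leads (extend a n b A \<inter> extend a n b B)"
    unfolding extend_Int[symmetric] leads_extend[OF subsp_Int[OF A B]] by blast
qed

lemma confluent_extend_disjoint:
  fixes A B :: "('x::{finite,linorder}, 'k::field) vec set"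
  assumes A: "subsp (words n) A" and B: "subsp (words n') B"
  shows "confluent (extend a n (c + n' + b) A) (extend (a + n + c) n' b B)"
  unfolding confluent_def
proof
  fix w assume w: "w \<in> leads (extend a n (c + n' + b) A) \<inter> leads (extend (a + n + c) n' b B)"
  obtain p u r where 1: "w = p @ u @ r" "length p = a" "length r = c + n' + b" "u \<in> leads A"
    using w unfolding leads_extend[OF A] by blast
  obtain p' u' s where 2: "w = p' @ u' @ s" "length p' = a + n + c" "length s = b" "u' \<in> leads B"
    using w unfolding leads_extend[OF B] by blast
  have u: "length u = n" and u': "length u' = n'"
    using 1 2 leads_sub[OF A] leads_sub[OF B] by auto
  define q where "q = take c r"
  have "r = drop (a + n) w" using 1 u by simp
  also have "\<dots> = drop (a + n) p' @ u' @ s" using 2 by simp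
  finally have r: "r = drop (a + n) p' @ u' @ s" .
  then have q: "length q = c" "r = q @ u' @ s" using 2 by (simp_all add: q_def)
  obtain f g where f: "f \<in> A" "lead f u" and g: "g \<in> B" "lead g u'"
    using 1 2 unfolding leads_def by blast
  let ?h = "\<lambda>v. if length v = a + n + c + n' + b \<and> take a v = p \<and> take c (drop (a + n) v) = q
      \<and> drop (a + n + c + n') v = s
    then f (take n (drop a v)) * g (take n' (drop (a + n + c) v)) else 0"
  have fz: "f v = 0" if "length v \<noteq> n" for v using subsp_supp[OF A f(1), of v] that by auto
  have gz: "g v = 0" if "length v \<noteq> n'" for v using subsp_supp[OF B g(1), of v] that by auto
  have "(\<lambda>v. ?h (x @ v @ y)) \<in> A" if "length x = a" "length y = c + n' + b" for x y
  proof -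
    have "(\<lambda>v. ?h (x @ v @ y)) = (\<lambda>v. (if x = p \<and> take c y = q \<and> drop (c + n') y = s
        then g (take n' (drop c y)) else 0) * f v)"
    proof
      fix v
      show "?h (x @ v @ y) = (if x = p \<and> take c y = q \<and> drop (c + n') y = s
        then g (take n' (drop c y)) else 0) * f v"
        using that fz[of v] 1(2) by (cases "length v = n") (auto simp: add.assoc)
    qed
    then show ?thesis using subsp_scale[OF A f(1)] by (simp only:)
  qed
  moreover have "(\<lambda>v. ?h (x @ v @ y)) \<in> B" if "length x = a + n + c" "length y = b" for x y
  proof -
    have "(\<lambda>v. ?h (x @ v @ y)) = (\<lambda>v. (if take a x = p \<and> drop (a + n) x = q \<and> y = s
        then f (take n (drop a x)) else 0) * g v)"
    proof
      fix v
      show "?h (x @ v @ y) = (if take a x = p \<and> drop (a + n) x = q \<and> y = s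
        then f (take n (drop a x)) else 0) * g v"
        using that gz[of v] by (cases "length v = n'") (auto simp: add.assoc)
    qed
    then show ?thesis using subsp_scale[OF B g(1)] by (simp only:)
  qed
  moreover have "deg (a + n + c + n' + b) ?h" by (simp add: deg_def)
  ultimately have "?h \<in> extend a n (c + n' + b) A \<inter> extend (a + n + c) n' b B"
    by (simp add: extend_def add.assoc)
  moreover have "v \<le> w" if "?h v \<noteq> 0" for v
  proof -
    have v: "length v = a + n + c + n' + b" "take a v = p" "take c (drop (a + n) v) = q"
      "drop (a + n + c + n') v = s"
      "f (take n (drop a v)) \<noteq> 0" "g (take n' (drop (a + n + c) v)) \<noteq> 0"
      using that by (auto split: if_splits)
    have "v = take a v @ take n (drop a v) @ take c (drop n (drop a v))
        @ take n' (drop c (drop n (drop a v))) @ drop n' (drop c (drop n (drop a v)))"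
      by (simp only: append_take_drop_id)
    then have "v = p @ take n (drop a v) @ q @ take n' (drop (a + n + c) v) @ s"
      using v(2-4) by (simp add: ac_simps)
    also have "\<dots> \<le> p @ u @ q @ u' @ s"
      using f(2) g(2) v u u'
      by (intro append_le_mono order.refl refl) (auto simp: lead_def)
    finally show ?thesis using 1 q by simp
  qed
  moreover have "?h w \<noteq> 0" using 1 q 2(3) u u' f(2) g(2) by (simp add: lead_def)
  ultimately have "lead ?h w" "?h \<in> extend a n (c + n' + b) A \<inter> extend (a + n + c) n' b B"
    unfolding lead_def by blast+
  then show "w \<in> leads (extend a n (c + n' + b) A \<inter> extend (a + n + c) n' b B)"
    unfolding leads_def by blast
qed

lemma deg_tensor:
  fixes g h :: "('x, 'k::field) vec"
  assumes "deg a g" "deg b h"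
  shows "deg (a + b) (\<lambda>v. g (take a v) * h (drop a v))"
  unfolding deg_def
proof (intro allI impI)
  fix v assume "g (take a v) * h (drop a v) \<noteq> 0"
  then have "length (take a v) = a" "length (drop a v) = b" using assms unfolding deg_def by auto
  then show "length v = a + b" by (simp add: min_def split: if_splits)
qed

lemma subsp_tens:
  assumes "\<And>g. g \<in> W \<Longrightarrow> deg a g" "\<And>h. h \<in> U \<Longrightarrow> deg b h"
  shows "subsp (words (a + b)) (tens a W U)"
  unfolding tens_def
proof (rule subsp_lspan)
  fix f v assume "f \<in> {(\<lambda>v. g (take a v) * h (drop a v)) | g h. g \<in> W \<and> h \<in> U}" "f v \<noteq> 0"
  then obtain g h where "g \<in> W" "h \<in> U" "f = (\<lambda>v. g (take a v) * h (drop a v))" by blast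
  then have "deg (a + b) f" using deg_tensor[of a g b h] assms by blast
  with \<open>f v \<noteq> 0\<close> show "v \<in> words (a + b)" by (simp add: deg_def)
qed

lemma tens_base: "g \<in> W \<Longrightarrow> h \<in> U \<Longrightarrow> (\<lambda>v. g (take a v) * h (drop a v)) \<in> tens a W U"
  unfolding tens_def by (rule lspan_base) blast

lemma tens_least:
  assumes "subsp Y Z" "\<And>g h. g \<in> W \<Longrightarrow> h \<in> U \<Longrightarrow> (\<lambda>v. g (take a v) * h (drop a v)) \<in> Z"
  shows "tens a W U \<subseteq> Z"
  unfolding tens_def using assms(2) by (intro lspan_least[OF assms(1)]) blast

lemma wv_in_Vm: "length w = m \<Longrightarrow> wv w \<in> Vm m"
  by (simp add: Vm_def deg_wv)

lemma tens_Vm_right: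
  fixes W :: "('x::finite, 'k::field) vec set"
  assumes W: "subsp (words a) W"
  shows "tens a W (Vm b) = extend 0 a b W"
proof
  show "tens a W (Vm b) \<subseteq> extend 0 a b W"
  proof (rule tens_least[OF subsp_extend[OF W]])
    fix g h :: "('x, 'k) vec" assume g: "g \<in> W" and h: "h \<in> Vm b"
    have dg: "deg a g" and dh: "deg b h" using subsp_deg[OF W g] h by (auto simp: Vm_def)
    let ?t = "\<lambda>v. g (take a v) * h (drop a v)"
    have dt: "deg (a + b) ?t" using dg dh by (rule deg_tensor)
    have "(\<lambda>u. ?t (u @ s)) \<in> W" if s: "length s = b" for s
    proof -
      have "(\<lambda>u. ?t (u @ s)) = (\<lambda>u. h s * g u)"
      proof
        fix u show "?t (u @ s) = h s * g u"
        proof (cases "length u = a")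
          case False
          then have "g u = 0" "length (u @ s) \<noteq> a + b" using dg s by (auto simp: deg_def)
          then have "g u = 0" "?t (u @ s) = 0" using dt unfolding deg_def by blast+
          then show ?thesis by simp
        qed simp
      qed
      then show ?thesis using subsp_scale[OF W g] by (simp only:)
    qed
    with dt show "?t \<in> extend 0 a b W" by (simp add: extend_def)
  qed
  show "extend 0 a b W \<subseteq> tens a W (Vm b)"
  proof
    fix f assume f: "f \<in> extend 0 a b W"
    have T: "subsp (words (a + b)) (tens a W (Vm b))"
      using subsp_deg[OF W] by (intro subsp_tens) (auto simp: Vm_def)
    have "(\<lambda>v. \<Sum>s\<in>words b. 1 * (\<lambda>s v. f (take a v @ s) * wv s (drop a v)) s v) \<in> tens a W (Vm b)"
    proof (rule subsp_sum[OF finite_words T])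
      fix s :: "'x list" assume s: "s \<in> words b"
      then have "(\<lambda>u. f (u @ s)) \<in> W" using f by (simp add: extend_def)
      then show "(\<lambda>v. f (take a v @ s) * wv s (drop a v)) \<in> tens a W (Vm b)"
        using tens_base[of "\<lambda>u. f (u @ s)" W "wv s" "Vm b" a] s wv_in_Vm[of s b] by simp
    qed
    moreover have "(\<Sum>s\<in>words b. f (take a v @ s) * wv s (drop a v)) = f v" for v
    proof -
      have "(\<Sum>s\<in>words b. f (take a v @ s) * wv s (drop a v))
          = (\<Sum>s\<in>words b. if s = drop a v then f v else 0)"
        by (intro sum.cong) (auto simp: wv_def)
      also have "\<dots> = f v" using f by (auto simp: extend_def deg_def)
      finally show ?thesis .
    qed
    ultimately show "f \<in> tens a W (Vm b)" by simp
  qed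
qed

lemma tens_Vm_left:
  fixes U :: "('x::finite, 'k::field) vec set"
  assumes U: "subsp (words b) U"
  shows "tens a (Vm a) U = extend a b 0 U"
proof
  show "tens a (Vm a) U \<subseteq> extend a b 0 U"
  proof (rule tens_least[OF subsp_extend[OF U]])
    fix g h :: "('x, 'k) vec" assume g: "g \<in> Vm a" and h: "h \<in> U"
    have "deg a g" "deg b h" using subsp_deg[OF U h] g by (auto simp: Vm_def)
    then have "deg (a + b) (\<lambda>v. g (take a v) * h (drop a v))" by (rule deg_tensor)
    then show "(\<lambda>v. g (take a v) * h (drop a v)) \<in> extend a b 0 U"
      using subsp_scale[OF U h] by (simp add: extend_def)
  qed
  show "extend a b 0 U \<subseteq> tens a (Vm a) U"
  proof
    fix f assume f: "f \<in> extend a b 0 U"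
    have T: "subsp (words (a + b)) (tens a (Vm a) U)"
      using subsp_deg[OF U] by (intro subsp_tens) (auto simp: Vm_def)
    have "(\<lambda>v. \<Sum>p\<in>words a. 1 * (\<lambda>p v. wv p (take a v) * f (p @ drop a v)) p v) \<in> tens a (Vm a) U"
    proof (rule subsp_sum[OF finite_words T])
      fix p :: "'x list" assume p: "p \<in> words a"
      then have "(\<lambda>u. f (p @ u)) \<in> U" using f by (simp add: extend_def)
      then show "(\<lambda>v. wv p (take a v) * f (p @ drop a v)) \<in> tens a (Vm a) U"
        using tens_base[of "wv p" "Vm a" "\<lambda>u. f (p @ u)" U a] p wv_in_Vm[of p a] by simp
    qed
    moreover have "(\<Sum>p\<in>words a. wv p (take a v) * f (p @ drop a v)) = f v" for v
    proof -
      have "(\<Sum>p\<in>words a. wv p (take a v) * f (p @ drop a v))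
          = (\<Sum>p\<in>words a. if p = take a v then f v else 0)"
        by (intro sum.cong) (auto simp: wv_def)
      also have "\<dots> = f v" using f by (auto simp: extend_def deg_def min_def)
      finally show ?thesis .
    qed
    ultimately show "f \<in> tens a (Vm a) U" by simp
  qed
qed

lemma tens_lspan_UN:
  fixes E :: "'i \<Rightarrow> ('x::finite, 'k::field) vec set"
  assumes E: "\<And>i. i \<in> I \<Longrightarrow> subsp (words c) (E i)"
  shows "tens c (lspan (\<Union>i\<in>I. E i)) (Vm l) = lspan (\<Union>i\<in>I. extend 0 c l (E i))"
proof
  let ?U = "\<Union>i\<in>I. E i" and ?L = "lspan (\<Union>i\<in>I. extend 0 c l (E i))"
  have SU: "subsp (words c) (lspan ?U)"
  proof (rule subsp_lspan)
    fix f v assume "f \<in> ?U" "f v \<noteq> 0"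
    then show "v \<in> words c" using subsp_supp[OF E] by blast
  qed
  have SL: "subsp (words (c + l)) ?L"
  proof (rule subsp_lspan)
    fix f v assume "f \<in> (\<Union>i\<in>I. extend 0 c l (E i))" "f v \<noteq> 0"
    then show "v \<in> words (c + l)" by (auto simp: extend_def deg_def)
  qed
  show "tens c (lspan ?U) (Vm l) \<subseteq> ?L"
  proof (rule tens_least[OF SL])
    fix g h :: "('x, 'k) vec" assume g: "g \<in> lspan ?U" and h: "h \<in> Vm l"
    let ?t = "\<lambda>g v. g (take c v) * h (drop c v)"
    let ?Z = "{g. deg c g \<and> ?t g \<in> ?L}"
    have "subsp (words c) ?Z"
      unfolding subsp_def
    proof (intro conjI ballI allI impI)
      show "(\<lambda>_. 0) \<in> ?Z" using subsp_zero[OF SL] by (simp add: deg_zero)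
      show "(\<lambda>v. f v + d * g v) \<in> ?Z" if "f \<in> ?Z" "g \<in> ?Z" for f g d
        using that subsp_lincomb[OF SL, of "?t f" "?t g" d]
        by (simp add: deg_lincomb distrib_right mult.assoc)
      show "v \<in> words c" if "f \<in> ?Z" "f v \<noteq> 0" for f v using that by (simp add: deg_def)
    qed
    moreover have "?U \<subseteq> ?Z"
    proof
      fix g assume "g \<in> ?U"
      then obtain i where i: "i \<in> I" "g \<in> E i" by blast
      have "?t g \<in> extend 0 c l (E i)"
        using tens_base[OF i(2) h, of c] unfolding tens_Vm_right[OF E[OF i(1)]] .
      then have "?t g \<in> ?L" using i(1) by (intro lspan_base) (rule UN_I)
      then show "g \<in> ?Z" using subsp_deg[OF E[OF i(1)] i(2)] by simp
    qed
    ultimately have "g \<in> ?Z" using lspan_least g by (meson subsetD)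
    then show "?t g \<in> ?L" by simp
  qed
  have "(\<Union>i\<in>I. extend 0 c l (E i)) \<subseteq> extend 0 c l (lspan ?U)"
  proof (rule UN_least)
    fix i assume "i \<in> I"
    then show "extend 0 c l (E i) \<subseteq> extend 0 c l (lspan ?U)" by (intro extend_mono) (blast intro: lspan_base)
  qed
  then show "?L \<subseteq> tens c (lspan ?U) (Vm l)"
    unfolding tens_Vm_right[OF SU] by (rule lspan_least[OF subsp_extend[OF SU]])
qed

section \<open>Side-confluent presentations\<close>

lemma lead_lm:
  fixes f :: "('x::{finite,linorder}, 'k::field) vec"
  assumes "deg m f" "f \<noteq> (\<lambda>_. 0)"
  shows "lead f (lm f)"
proof -
  obtain w where w: "lead f w"
    using lead_ex[OF finite_words[of m], of f] assms unfolding deg_def by (metis words_iff)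
  have "(f v \<noteq> 0 \<and> (\<forall>u. f u \<noteq> 0 \<longrightarrow> u = v \<or> lexordp (<) u v)) \<longleftrightarrow> lead f v" for v
    unfolding lead_def lexordp_iff_less by (auto simp: order.order_iff_strict)
  then have "lm f = (THE v. lead f v)" unfolding lm_def by simp
  also have "\<dots> = w" using w lead_unique by blast
  finally show ?thesis using w by simp
qed

lemma reduced_presD:
  fixes R :: "('x::{finite,linorder}, 'k::field) vec set"
  assumes "reduced_pres N R" "f \<in> R"
  shows "deg N f" "lead f (lm f)" "f (lm f) = 1" "length (lm f) = N"
    "f w \<noteq> 0 \<Longrightarrow> w \<noteq> lm f \<Longrightarrow> g \<in> R \<Longrightarrow> lm g \<noteq> w"
    "g \<in> R \<Longrightarrow> lm g = lm f \<Longrightarrow> g = f"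
proof -
  have refl: "factor w w" for w :: "'x list"
    unfolding factor_def by (intro exI[of _ "[]"]) simp
  show d: "deg N f" and l: "lead f (lm f)" and "f (lm f) = 1"
    using assms lead_lm[of N f] unfolding reduced_pres_def Vm_def by auto
  show "length (lm f) = N" using d l by (simp add: deg_def lead_def)
  show "g \<in> R \<Longrightarrow> lm g = lm f \<Longrightarrow> g = f"
    using assms refl unfolding reduced_pres_def by metis
  show "lm g \<noteq> w" if "f w \<noteq> 0" "w \<noteq> lm f" "g \<in> R"
  proof -
    have "(wv (lm f) - f) w \<noteq> 0" using that by (simp add: wv_def)
    then have "normal_form R w" using assms unfolding reduced_pres_def by blast
    then show ?thesis using that refl unfolding normal_form_def by metis
  qed
qed

lemma subsp_Rbar:
  fixes R :: "('x::{finite,linorder}, 'k::field) vec set"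
  assumes "reduced_pres N R"
  shows "subsp (words N) (Rbar R)"
  unfolding Rbar_def using reduced_presD(1)[OF assms]
  by (intro subsp_lspan) (auto simp: deg_def)

lemma Sop_lm:
  fixes R :: "('x::{finite,linorder}, 'k::field) vec set"
  assumes R: "reduced_pres N R" and f: "f \<in> R"
  shows "Sop N R (lm f) = (\<lambda>v. wv (lm f) v - f v)"
proof -
  have "(THE g. g \<in> R \<and> lm g = lm f) = f"
    using f reduced_presD(6)[OF R f] by (intro the_equality) auto
  then show ?thesis using f reduced_presD(4)[OF R f] unfolding Sop_def by auto
qed

lemma Sop_other:
  assumes "length w = N" "\<And>f. f \<in> R \<Longrightarrow> lm f \<noteq> w"
  shows "Sop N R w = wv w"
  using assms unfolding Sop_def by auto

lemma deg_Sop: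
  fixes R :: "('x::{finite,linorder}, 'k::field) vec set"
  assumes R: "reduced_pres N R"
  shows "deg N (Sop N R w)"
proof (cases "\<exists>f\<in>R. lm f = w")
  case True
  then obtain f where f: "f \<in> R" "w = lm f" by blast
  have "deg N (\<lambda>v. wv w v + (-1) * f v)"
    using reduced_presD(1,4)[OF R f(1)] f(2) by (intro deg_lincomb deg_wv) auto
  then show ?thesis using Sop_lm[OF R f(1)] f(2) by simp
next
  case False
  then show ?thesis by (auto simp: Sop_def deg_wv deg_zero)
qed

lemma Sop_le:
  fixes R :: "('x::{finite,linorder}, 'k::field) vec set"
  assumes R: "reduced_pres N R" and w: "length w = N" and "Sop N R w v \<noteq> 0"
  shows "v \<le> w"
proof (cases "\<exists>f\<in>R. lm f = w")
  case True
  then obtain f where f: "f \<in> R" "w = lm f" by blast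
  then have "v = w \<or> f v \<noteq> 0"
    using assms(3) Sop_lm[OF R f(1)] by (auto simp: wv_def split: if_splits)
  then show ?thesis using reduced_presD(2)[OF R f(1)] f(2) by (auto simp: lead_def)
next
  case False
  then have "Sop N R w = wv w" using w by (intro Sop_other) auto
  then show ?thesis using assms(3) by (simp add: wv_def split: if_splits)
qed

lemma Sop_fixes:
  fixes R :: "('x::{finite,linorder}, 'k::field) vec set"
  assumes R: "reduced_pres N R" and w: "length w = N" "w \<notin> leads (Rbar R)"
  shows "Sop N R w = wv w"
proof (rule Sop_other[OF w(1)])
  fix f assume "f \<in> R"
  then have "f \<in> Rbar R" "lead f (lm f)"
    using lspan_base reduced_presD(2)[OF R] unfolding Rbar_def by auto
  then show "lm f \<noteq> w" using w(2) unfolding leads_def by blast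
qed

lemma app_Sop_Rbar:
  fixes R :: "('x::{finite,linorder}, 'k::field) vec set"
  assumes R: "reduced_pres N R" and f: "f \<in> Rbar R"
  shows "app (Sop N R) f = (\<lambda>_. 0)"
proof -
  let ?S = "Sop N R"
  have "f \<in> ker N ?S" if f: "f \<in> R" for f
  proof -
    note d = reduced_presD(1)[OF R f] and l = reduced_presD(4)[OF R f]
    have "f w * ?S w v = f w * wv w v - (if w = lm f then f v else 0)" if "length w = N" for w v
    proof (cases "f w \<noteq> 0 \<and> w \<noteq> lm f")
      case True
      then have "?S w = wv w" using that reduced_presD(5)[OF R f, of w] by (intro Sop_other) auto
      with True show ?thesis by simp
    next
      case False
      then show ?thesis
        using Sop_lm[OF R f] reduced_presD(3)[OF R f] by auto
    qed
    then have "app ?S f v = (\<Sum>w\<in>words N. f w * wv w v) - (\<Sum>w\<in>words N. if w = lm f then f v else 0)"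
      for v unfolding app_words[OF d] sum_subtractf[symmetric] by (intro sum.cong) auto
    moreover have "(\<Sum>w\<in>words N. f w * wv w v) = f v" for v
    proof -
      have "(\<Sum>w\<in>words N. f w * wv w v) = (\<Sum>w\<in>words N. if w = v then f v else 0)"
        by (intro sum.cong) (auto simp: wv_def)
      then show ?thesis using d by (auto simp: deg_def)
    qed
    ultimately have "app ?S f v = 0" for v using l by simp
    then show ?thesis using d by (simp add: ker_def fun_eq_iff)
  qed
  then have "Rbar R \<subseteq> ker N ?S"
    unfolding Rbar_def by (intro lspan_least[OF subsp_ker]) auto
  with f show ?thesis unfolding ker_def by blast
qed

lemma deg_optens:
  fixes T U :: "('x, 'k::field) op"
  assumes "\<And>w. deg a (T w)" "\<And>w. deg b (U w)"
  shows "deg (a + b) (optens a T b U w)"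
  unfolding optens_def using deg_tensor[OF assms] by (simp add: deg_zero)

lemma sum_words_append_right:
  fixes F :: "'x::finite list \<Rightarrow> 'k::comm_monoid_add"
  assumes s: "length s = b" and F: "\<And>w. length w = a + b \<Longrightarrow> drop a w \<noteq> s \<Longrightarrow> F w = 0"
  shows "(\<Sum>w\<in>words (a + b). F w) = (\<Sum>u\<in>words a. F (u @ s))"
proof -
  have "(\<Sum>w\<in>words (a + b). F w) = (\<Sum>w\<in>(\<lambda>u. u @ s) ` words a. F w)"
  proof (rule sum.mono_neutral_right)
    show "\<forall>w\<in>words (a + b) - (\<lambda>u. u @ s) ` words a. F w = 0"
    proof
      fix w assume w: "w \<in> words (a + b) - (\<lambda>u. u @ s) ` words a"
      have "w = take a w @ drop a w" "take a w \<in> words a" using w by simp_all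
      then have "drop a w \<noteq> s" using w by blast
      then show "F w = 0" using F w by simp
    qed
  qed (use s in auto)
  also have "\<dots> = (\<Sum>u\<in>words a. F (u @ s))" by (subst sum.reindex) (auto simp: inj_on_def)
  finally show ?thesis .
qed

lemma sum_words_append_left:
  fixes F :: "'x::finite list \<Rightarrow> 'k::comm_monoid_add"
  assumes p: "length p = a" and F: "\<And>w. length w = a + b \<Longrightarrow> take a w \<noteq> p \<Longrightarrow> F w = 0"
  shows "(\<Sum>w\<in>words (a + b). F w) = (\<Sum>u\<in>words b. F (p @ u))"
proof -
  have "(\<Sum>w\<in>words (a + b). F w) = (\<Sum>w\<in>(\<lambda>u. p @ u) ` words b. F w)"
  proof (rule sum.mono_neutral_right)
    show "\<forall>w\<in>words (a + b) - (\<lambda>u. p @ u) ` words b. F w = 0"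
    proof
      fix w assume w: "w \<in> words (a + b) - (\<lambda>u. p @ u) ` words b"
      have "w = take a w @ drop a w" "drop a w \<in> words b" using w by simp_all
      then have "take a w \<noteq> p" using w by blast
      then show "F w = 0" using F w by simp
    qed
  qed (use p in auto)
  also have "\<dots> = (\<Sum>u\<in>words b. F (p @ u))" by (subst sum.reindex) (auto simp: inj_on_def)
  finally show ?thesis .
qed

lemma app_optens_right:
  fixes T :: "('x::finite, 'k::field) op"
  assumes f: "deg (a + b) f" and v: "length v = a + b" and slice: "deg a (\<lambda>u. f (u @ drop a v))"
  shows "app (optens a T b (idm b)) f v = app T (\<lambda>u. f (u @ drop a v)) (take a v)"
proof -
  have "app (optens a T b (idm b)) f v
      = (\<Sum>u\<in>words a. f (u @ drop a v) * optens a T b (idm b) (u @ drop a v) v)"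
    unfolding app_words[OF f]
    by (rule sum_words_append_right) (use v in \<open>auto simp: optens_def idm_def wv_def\<close>)
  also have "\<dots> = (\<Sum>u\<in>words a. f (u @ drop a v) * T u (take a v))"
    using v by (intro sum.cong) (auto simp: optens_def idm_def wv_def)
  finally show ?thesis unfolding app_words[OF slice] .
qed

lemma app_optens_left:
  fixes T :: "('x::finite, 'k::field) op"
  assumes f: "deg (a + b) f" and v: "length v = a + b" and slice: "deg b (\<lambda>u. f (take a v @ u))"
  shows "app (optens a (idm a) b T) f v = app T (\<lambda>u. f (take a v @ u)) (drop a v)"
proof -
  have "app (optens a (idm a) b T) f v
      = (\<Sum>u\<in>words b. f (take a v @ u) * optens a (idm a) b T (take a v @ u) v)"
    unfolding app_words[OF f]
    by (rule sum_words_append_left) (use v in \<open>auto simp: optens_def idm_def wv_def\<close>)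
  also have "\<dots> = (\<Sum>u\<in>words b. f (take a v @ u) * T u (drop a v))"
    using v by (intro sum.cong) (auto simp: optens_def idm_def wv_def)
  finally show ?thesis unfolding app_words[OF slice] .
qed

lemma deg_idm: "deg m (idm m w)"
  by (simp add: idm_def deg_wv deg_zero)

lemma wv_append:
  "length u = a \<Longrightarrow> (\<lambda>v. wv u (take a v) * wv s (drop a v)) = (wv (u @ s) :: ('x, 'k::field) vec)"
  by (rule ext) (auto simp: wv_def, metis append_take_drop_id)

lemma confluent_overlap:
  fixes R :: "('x::{finite,linorder}, 'k::field) vec set"
  assumes R: "reduced_pres N R" and sc: "side_confluent N R" and m: "1 \<le> m" "m \<le> N - 1"
  shows "confluent (extend 0 N m (Rbar R)) (extend m N 0 (Rbar R))"
proof -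
  let ?S = "Sop N R"
  let ?A = "extend 0 N m (Rbar R)" and ?B = "extend m N 0 (Rbar R)"
  let ?s = "optens N ?S m (idm m)" and ?t = "optens m (idm m) N ?S"
  note SR = subsp_Rbar[OF R]
  obtain k where k: "k \<ge> 1" "alt (N + m) ?t ?s k = alt (N + m) ?s ?t k"
    using sc m unfolding side_confluent_def by blast
  have A: "subsp (words (N + m)) ?A" using subsp_extend[OF SR, of 0 m] by simp
  have B: "subsp (words (N + m)) ?B" using subsp_extend[OF SR, of m 0] by (simp add: add.commute)
  have dA: "deg (N + m) f" if "f \<in> ?A" for f using subsp_deg[OF A that] .
  have dB: "deg (m + N) f" if "f \<in> ?B" for f using subsp_deg[OF B that] by (simp add: add.commute)
  have ds: "deg (N + m) (?s w)" for w by (rule deg_optens[OF deg_Sop[OF R] deg_idm])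
  have dt: "deg (m + N) (?t w)" for w by (rule deg_optens[OF deg_idm deg_Sop[OF R]])
  show ?thesis
  proof (rule confluent_if_alt_eq[OF A B _ _ _ _ _ _ _ _ k(2,1)])
    show "deg (N + m) (?s w)" for w by (rule ds)
    show "deg (N + m) (?t w)" for w using dt by (simp add: add.commute)
    show "v \<le> u" if u: "length u = N + m" and nz: "?s u v \<noteq> 0" for u v
    proof -
      have v: "length v = N + m" using nz ds by (simp add: deg_def)
      have "take N v \<le> take N u" "drop N v = drop N u"
        using u nz Sop_le[OF R, of "take N u" "take N v"]
        by (auto simp: optens_def idm_def wv_def split: if_splits)
      then have "take N v @ drop N v \<le> take N u @ drop N u"
        using u v by (intro append_le_mono) auto
      then show ?thesis by simp
    qed
    show "v \<le> u" if u: "length u = N + m" and nz: "?t u v \<noteq> 0" for u v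
    proof -
      have v: "length v = m + N" using nz dt by (simp add: deg_def)
      have "take m v = take m u" "drop m v \<le> drop m u"
        using u nz Sop_le[OF R, of "drop m u" "drop m v"]
        by (auto simp: optens_def idm_def wv_def split: if_splits)
      then have "take m v @ drop m v \<le> take m u @ drop m u"
        using u v by (intro append_le_mono) auto
      then show ?thesis by simp
    qed
    show "?s w = wv w" if w: "length w = N + m" "w \<notin> leads ?A" for w
    proof -
      have "take N w \<notin> leads (Rbar R)"
      proof
        assume "take N w \<in> leads (Rbar R)"
        then have "[] @ take N w @ drop N w \<in> leads ?A"
          unfolding leads_extend[OF SR] using w(1)
          by (intro CollectI exI[of _ "[]"] exI[of _ "take N w"] exI[of _ "drop N w"]) simp
        with w(2) show False by simp
      qed
      then have "?S (take N w) = wv (take N w)" using w by (intro Sop_fixes[OF R]) auto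
      then show ?thesis
        using w(1) wv_append[of "take N w" N "drop N w"] by (simp add: optens_def idm_def)
    qed
    show "?t w = wv w" if w: "length w = N + m" "w \<notin> leads ?B" for w
    proof -
      have "drop m w \<notin> leads (Rbar R)"
      proof
        assume "drop m w \<in> leads (Rbar R)"
        then have "take m w @ drop m w @ [] \<in> leads ?B"
          unfolding leads_extend[OF SR] using w(1)
          by (intro CollectI exI[of _ "take m w"] exI[of _ "drop m w"] exI[of _ "[]"]) simp
        with w(2) show False by simp
      qed
      then have "?S (drop m w) = wv (drop m w)" using w by (intro Sop_fixes[OF R]) auto
      then show ?thesis
        using w(1) wv_append[of "take m w" m "drop m w"] by (simp add: optens_def idm_def add.commute)
    qed
    show "app ?s f = (\<lambda>_. 0)" if f: "f \<in> ?A" for f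
    proof
      fix v
      show "app ?s f v = 0"
      proof (cases "length v = N + m")
        case True
        have *: "(\<lambda>u. f (u @ drop N v)) \<in> Rbar R" using f True by (simp add: extend_def)
        show ?thesis
          unfolding app_optens_right[OF dA[OF f] True subsp_deg[OF SR *]] app_Sop_Rbar[OF R *] ..
      next
        case False
        then show ?thesis using deg_app[of "N + m" ?s f, OF ds] by (auto simp: deg_def)
      qed
    qed
    show "app ?t f = (\<lambda>_. 0)" if f: "f \<in> ?B" for f
    proof
      fix v
      show "app ?t f v = 0"
      proof (cases "length v = m + N")
        case True
        have *: "(\<lambda>u. f (take m v @ u)) \<in> Rbar R" using f True by (simp add: extend_def)
        show ?thesis
          unfolding app_optens_left[OF dB[OF f] True subsp_deg[OF SR *]] app_Sop_Rbar[OF R *] ..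
      next
        case False
        then show ?thesis using deg_app[of "m + N" ?t f, OF dt] by (auto simp: deg_def)
      qed
    qed
  qed
qed

lemma confluent_shifts:
  fixes R :: "('x::{finite,linorder}, 'k::field) vec set"
  assumes R: "reduced_pres N R" and sc: "side_confluent N R"
    and "i + N \<le> m" "j + N \<le> m"
  shows "confluent (extend i N (m - N - i) (Rbar R)) (extend j N (m - N - j) (Rbar R))"
proof -
  note SR = subsp_Rbar[OF R]
  have *: "confluent (extend i N (m - N - i) (Rbar R)) (extend j N (m - N - j) (Rbar R))"
    if ij: "i < j" "j + N \<le> m" for i j
  proof (cases "j < i + N")
    case True
    define d b where "d = j - i" and "b = m - N - j"
    have db: "1 \<le> d" "d \<le> N - 1" "j = i + d" "m - N - i = d + b" "m - N - j = b"
      using True ij by (auto simp: d_def b_def)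
    have S1: "subsp (words (N + d)) (extend 0 N d (Rbar R))"
      and S2: "subsp (words (N + d)) (extend d N 0 (Rbar R))"
      using subsp_extend[OF SR, of 0 d] subsp_extend[OF SR, of d 0] by (simp_all add: add.commute)
    have "confluent (extend i (N + d) b (extend 0 N d (Rbar R))) (extend i (N + d) b (extend d N 0 (Rbar R)))"
      by (rule confluent_extend[OF S1 S2 confluent_overlap[OF R sc db(1,2)]])
    moreover have "extend i (N + d) b (extend 0 N d (Rbar R)) = extend i N (d + b) (Rbar R)"
      using extend_extend[of i 0 N d b "Rbar R"] by simp
    moreover have "extend i (N + d) b (extend d N 0 (Rbar R)) = extend (i + d) N b (Rbar R)"
      using extend_extend[of i d N 0 b "Rbar R"] by (simp add: add.commute)
    ultimately show ?thesis unfolding db(4,5) by (simp add: db(3))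
  next
    case False
    define c b where "c = j - (i + N)" and "b = m - N - j"
    have cb: "j = i + N + c" "m - N - i = c + N + b" "m - N - j = b"
      using False ij by (auto simp: c_def b_def)
    show ?thesis using confluent_extend_disjoint[OF SR SR, of i c b] unfolding cb(2,3) by (simp add: cb(1))
  qed
  show ?thesis
  proof (cases i j rule: linorder_cases)
    case less
    then show ?thesis using * assms by blast
  next
    case equal
    then show ?thesis by (simp add: confluent_subset)
  next
    case greater
    then show ?thesis using * assms confluent_commute by blast
  qed
qed

lemma tens_shift:
  fixes R :: "('x::{finite,linorder}, 'k::field) vec set"
  assumes R: "reduced_pres N R"
  shows "tens i (Vm i) (tens N (Rbar R) (Vm b)) = extend i N b (Rbar R)"
proof -
  have S: "subsp (words (N + b)) (extend 0 N b (Rbar R))"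
    using subsp_extend[OF subsp_Rbar[OF R], of 0 b] by simp
  show ?thesis
    using extend_extend[of i 0 N b 0 "Rbar R"]
    by (simp add: tens_Vm_right[OF subsp_Rbar[OF R]] tens_Vm_left[OF S])
qed

lemma subsp_shift:
  fixes R :: "('x::{finite,linorder}, 'k::field) vec set"
  assumes "reduced_pres N R" "i + N \<le> m"
  shows "subsp (words m) (extend i N (m - N - i) (Rbar R))"
  using subsp_extend[OF subsp_Rbar[OF assms(1)], of i "m - N - i"] assms(2) by simp

lemma IR_eq:
  fixes R :: "('x::{finite,linorder}, 'k::field) vec set"
  assumes R: "reduced_pres N R"
  shows "IR N R c = lspan (\<Union>i\<in>{i. i + N \<le> c}. extend i N (c - N - i) (Rbar R))"
proof (cases "c < N")
  case True
  then have "{i. i + N \<le> c} = {}" by auto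
  with True show ?thesis by (simp add: IR_def lspan_empty)
next
  case False
  then have "{0..c - N} = {i. i + N \<le> c}" by auto
  then show ?thesis using False by (simp add: IR_def tens_shift[OF R])
qed

lemma F1_kernel_eq:
  fixes R :: "('x::{finite,linorder}, 'k::field) vec set"
  assumes R: "reduced_pres N R" and "l \<le> m"
  shows "tens (m - l) (IR N R (m - l)) (Vm l)
    = lspan (\<Union>i\<in>{i. i + N \<le> m - l}. extend i N (m - N - i) (Rbar R))"
proof -
  let ?c = "m - l"
  have "extend 0 ?c l (extend i N (?c - N - i) (Rbar R)) = extend i N (m - N - i) (Rbar R)"
    if i: "i + N \<le> ?c" for i
  proof -
    have "i + N + (?c - N - i) = ?c" "?c - N - i + l = m - N - i" using i assms(2) by auto
    then show ?thesis using extend_extend[of 0 i N "?c - N - i" l "Rbar R"] by (simp only: add_0)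
  qed
  then have "(\<Union>i\<in>{i. i + N \<le> ?c}. extend 0 ?c l (extend i N (?c - N - i) (Rbar R)))
      = (\<Union>i\<in>{i. i + N \<le> ?c}. extend i N (m - N - i) (Rbar R))" by auto
  moreover have "tens ?c (lspan (\<Union>i\<in>{i. i + N \<le> ?c}. extend i N (?c - N - i) (Rbar R))) (Vm l)
      = lspan (\<Union>i\<in>{i. i + N \<le> ?c}. extend 0 ?c l (extend i N (?c - N - i) (Rbar R)))"
    by (intro tens_lspan_UN subsp_shift[OF R]) simp
  ultimately show ?thesis unfolding IR_eq[OF R] by (simp only:)
qed

lemma lN_ge: "n \<ge> 2 \<Longrightarrow> N \<le> lN N n"
proof -
  assume "n \<ge> 2"
  then have "1 * N \<le> n div 2 * N" by (intro mult_le_mono1) linarith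
  then show ?thesis unfolding lN_def by linarith
qed

lemma J_eq:
  fixes R :: "('x::{finite,linorder}, 'k::field) vec set"
  assumes R: "reduced_pres N R" and n: "n \<ge> 2"
  shows "J N R n = (\<Inter>i\<in>{0..lN N n - N}. extend i N (lN N n - N - i) (Rbar R))"
proof (cases "n = 2")
  case True
  have "lN N 2 = N" by (simp add: lN_def)
  moreover have "extend 0 N 0 (Rbar R) = Rbar R"
    using subsp_deg[OF subsp_Rbar[OF R]] by (auto simp: extend_def)
  ultimately show ?thesis using True by (simp add: J_def)
next
  case False
  then show ?thesis using n by (simp add: J_def tens_shift[OF R])
qed

lemma F2_kernel_eq:
  fixes R :: "('x::{finite,linorder}, 'k::field) vec set"
  assumes R: "reduced_pres N R" and n: "n \<ge> 2" and m: "lN N n \<le> m"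
  shows "tens (m - lN N n) (Vm (m - lN N n)) (J N R n)
    = (\<Inter>i\<in>{m - lN N n..m - N}. extend i N (m - N - i) (Rbar R))"
proof -
  define l a where "l = lN N n" and "a = m - l"
  have l: "N \<le> l" "m = a + l" using lN_ge[OF n, of N] m by (auto simp: l_def a_def)
  let ?E = "\<lambda>i. extend i N (l - N - i) (Rbar R)"
  have E: "subsp (words l) (?E i)" if "i \<in> {0..l - N}" for i
    using that l by (intro subsp_shift[OF R]) auto
  have "tens a (Vm a) (\<Inter>i\<in>{0..l - N}. ?E i) = extend a l 0 (\<Inter>i\<in>{0..l - N}. ?E i)"
    by (intro tens_Vm_left subsp_INT E) auto
  also have "\<dots> = (\<Inter>i\<in>{0..l - N}. extend a l 0 (?E i))" by (rule extend_INT) simp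
  also have "\<dots> = (\<Inter>i\<in>{0..l - N}. extend (a + i) N (m - N - (a + i)) (Rbar R))"
  proof (rule INF_cong[OF refl])
    fix i assume "i \<in> {0..l - N}"
    then have "i + N + (l - N - i) = l" "m - N - (a + i) = l - N - i" using l by auto
    then show "extend a l 0 (?E i) = extend (a + i) N (m - N - (a + i)) (Rbar R)"
      using extend_extend[of a i N "l - N - i" 0 "Rbar R"] by (simp only: add_0_right)
  qed
  also have "\<dots> = (\<Inter>i\<in>(+) a ` {0..l - N}. extend i N (m - N - i) (Rbar R))"
    by (simp only: image_image)
  also have "(+) a ` {0..l - N} = {a..m - N}" using l by (simp add: ac_simps)
  finally show ?thesis unfolding J_eq[OF R n] l_def a_def .
qed

theorem theorem4p1p4:
  fixes N :: nat and R :: "('x::{finite,linorder}, 'k::field) vec set"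
  assumes "N \<ge> 2"
    and "reduced_pres N R"
    and "side_confluent N R"
  shows "\<forall>n m. m \<ge> lN N n \<longrightarrow>
     (\<exists>k\<ge>1. alt m (F1 N R n m) (F2 N R n m) k = alt m (F2 N R n m) (F1 N R n m) k)"
proof (intro allI impI)
  fix n m assume nm: "m \<ge> lN N n"
  note R = assms(2)
  let ?E = "\<lambda>i. extend i N (m - N - i) (Rbar R)"
  let ?I = "{i. i + N \<le> m - lN N n}"
  have E: "subsp (words m) (?E i)" if "i + N \<le> m" for i using that by (rule subsp_shift[OF R])
  have finI: "finite ?I" by (rule finite_subset[of _ "{..m}"]) auto
  have S1: "subsp (words m) (lspan (\<Union>i\<in>?I. ?E i))"
  proof (rule subsp_lspan)
    fix f v assume "f \<in> (\<Union>i\<in>?I. ?E i)" "f v \<noteq> 0"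
    then obtain i where "i + N \<le> m - lN N n" "f \<in> ?E i" by blast
    then show "v \<in> words m" using subsp_supp[OF E, of i f v] \<open>f v \<noteq> 0\<close> by linarith
  qed
  define T where "T = F1 N R n m"
  have T: "reduction_op m T" "ker m T = lspan (\<Union>i\<in>?I. ?E i)"
    using theta_inv[OF S1] unfolding T_def F1_def F1_kernel_eq[OF R nm] by simp_all
  define U where "U = F2 N R n m"
  have "reduction_op m U \<and> confluent (ker m T) (ker m U)"
  proof (cases "m < lN N (n + 1)")
    case True
    then have "U = idm m" by (simp add: U_def F2_def)
    then show ?thesis by (simp add: reduction_op_idm ker_idm confluent_def)
  next
    case False
    let ?a = "m - lN N (n + 1)"
    show ?thesis
    proof (cases "n = 0")
      case True
      have "tens ?a (Vm ?a) (J N R (n + 1)) = extend (m - 1) 1 0 (Vm 1)"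
        using True tens_Vm_left[OF subsp_Vm, of ?a 1] by (simp add: J_def lN_def)
      also have "\<dots> = Vm m"
        using False True extend_Vm[of "m - 1" 1 0] by (simp add: lN_def)
      finally have K: "tens ?a (Vm ?a) (J N R (n + 1)) = Vm m" .
      have U: "reduction_op m U" "ker m U = Vm m"
        using False theta_inv[OF subsp_Vm] unfolding U_def F2_def K by simp_all
      have "ker m T \<subseteq> Vm m" by (auto simp: ker_def Vm_def)
      with U show ?thesis by (simp add: confluent_subset)
    next
      case n: False
      let ?J = "{?a..m - N}"
      have n2: "n + 1 \<ge> 2" using n by simp
      have l: "lN N (n + 1) \<le> m" "N \<le> m" using False lN_ge[OF n2, of N] by auto
      have J: "?J \<noteq> {}" using lN_ge[OF n2, of N] by auto
      have iJ: "i + N \<le> m" if "i \<in> ?J" for i using that l by auto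
      have S2: "subsp (words m) (\<Inter>i\<in>?J. ?E i)" using J E iJ by (intro subsp_INT) auto
      have U: "reduction_op m U" "ker m U = (\<Inter>i\<in>?J. ?E i)"
        using False theta_inv[OF S2] unfolding U_def F2_def F2_kernel_eq[OF R n2 l(1)] by simp_all
      have pair: "confluent (?E i) (?E j)" if "i + N \<le> m" "j + N \<le> m" for i j
        using that by (rule confluent_shifts[OF R assms(3)])
      have "confluent (?E i) (\<Inter>i\<in>?J. ?E i)" if "i + N \<le> m" for i
        unfolding confluent_commute[of "?E i"] using J E iJ pair that
        by (intro confluent_INT[OF finite_words[of m]]) auto
      then have "confluent (lspan (\<Union>i\<in>?I. ?E i)) (\<Inter>i\<in>?J. ?E i)"
        using finI E pair by (intro confluent_lspan_UN[OF finite_words[of m]]) auto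
      with T U show ?thesis by simp
    qed
  qed
  then show "\<exists>k\<ge>1. alt m (F1 N R n m) (F2 N R n m) k = alt m (F2 N R n m) (F1 N R n m) k"
    using alt_eq_if_confluent[OF T(1), of U] unfolding T_def U_def by blast
qed

end
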